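(* Let $G$ be a non-abelian, $2$-step nilpotent Lie group. Then no left-invariant Riemannian metric on $G$ is weakly Einstein.
   Context: An $n$-dimensional Riemannian manifold $(M,g)$ is called weakly Einstein if $\check{R}_{ij}:=R_{iabc}R_{j}{}^{abc}=\frac{\|R\|^2}{n}g_{ij}$, where $R$ is the Riemann curvature tensor (indices raised with $g$, repeated indices summed) and $\|R\|^2=R_{iabc}R^{iabc}$. The function $\|R\|^2$ is not required to be constant in the definition, and Einstein manifolds are not excluded. The curvature tensor is $R(X,Y,U,V)=\langle(\nabla_X\nabla_Y-\nabla_Y\nabla_X-\nabla_{[X,Y]})U,V\rangle$, with $\nabla$ the Levi-Civita connection. Lie groups are taken to be connected, so that being non-abelian and $2$-step nilpotent are properties of the Lie algebra $\mathfrak{n}$ of $G$: $[\mathfrak{n},\mathfrak{n}]\neq 0$ and $[\mathfrak{n},[\mathfrak{n},\mathfrak{n}]]=0$. *)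

theory Defs
  imports "HOL-Analysis.Analysis"
begin

section \<open>Smooth maps between normed spaces\<close>

text \<open>For open \<open>S\<close> in a finite-dimensional space, \<open>Ck_on k S f\<close> says that \<open>f\<close> is of class
  \<open>C^k\<close> on \<open>S\<close>.\<close>

primrec Ck_on :: "nat \<Rightarrow> 'a::real_normed_vector set \<Rightarrow> ('a \<Rightarrow> 'b::real_normed_vector) \<Rightarrow> bool" where
  "Ck_on 0 S f \<longleftrightarrow> continuous_on S f"
| "Ck_on (Suc k) S f \<longleftrightarrow> (\<forall>x\<in>S. f differentiable (at x)) \<and>
     (\<forall>v. Ck_on k S (\<lambda>x. frechet_derivative f (at x) v))"

definition smooth_on :: "'a::real_normed_vector set \<Rightarrow> ('a \<Rightarrow> 'b::real_normed_vector) \<Rightarrow> bool" where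
  "smooth_on S f \<longleftrightarrow> (\<forall>k. Ck_on k S f)"


section \<open>Smooth manifolds\<close>

text \<open>The manifold is the whole type \<open>'a\<close>, with its topology; the model space is
  \<open>real ^ 'n\<close>, so the dimension is \<open>CARD('n)\<close>. A chart is a pair of its domain and its
  coordinate map.\<close>

type_synonym ('a, 'n) chart = "'a set \<times> ('a \<Rightarrow> real ^ 'n)"

definition chart_image :: "('a, 'n) chart \<Rightarrow> (real ^ 'n) set" where
  "chart_image c = snd c ` fst c"

definition chart_inv :: "('a, 'n) chart \<Rightarrow> real ^ 'n \<Rightarrow> 'a" where
  "chart_inv c = inv_into (fst c) (snd c)"

definition smooth_atlas ::
  "('a::{t2_space,second_countable_topology}, 'n::finite) chart set \<Rightarrow> bool" where
  "smooth_atlas A \<longleftrightarrow>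
     (\<Union>c\<in>A. fst c) = UNIV \<and>
     (\<forall>c\<in>A. open (fst c) \<and> open (chart_image c) \<and>
        homeomorphism (fst c) (chart_image c) (snd c) (chart_inv c)) \<and>
     (\<forall>c\<in>A. \<forall>d\<in>A. smooth_on (snd c ` (fst c \<inter> fst d)) (snd d \<circ> chart_inv c))"

definition smooth_fun :: "('a, 'n::finite) chart set \<Rightarrow> ('a \<Rightarrow> real) \<Rightarrow> bool" where
  "smooth_fun A f \<longleftrightarrow> (\<forall>c\<in>A. smooth_on (chart_image c) (f \<circ> chart_inv c))"

text \<open>Around every point \<open>p\<close> a reference chart is chosen once and for all. The tangent space at
  \<open>p\<close> is \<open>real ^ 'n\<close>, a tangent vector being represented by its components in the reference
  chart at \<open>p\<close>. Nothing below depends on the choice, except through this identification.\<close>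

definition chart_at :: "('a, 'n) chart set \<Rightarrow> 'a \<Rightarrow> ('a, 'n) chart" where
  "chart_at A p = (SOME c. c \<in> A \<and> p \<in> fst c)"

definition coords_at :: "('a, 'n) chart set \<Rightarrow> 'a \<Rightarrow> real ^ 'n" where
  "coords_at A p = snd (chart_at A p) p"

text \<open>The differential at \<open>p\<close> of a map of the manifold to itself.\<close>

definition differential ::
  "('a, 'n::finite) chart set \<Rightarrow> ('a \<Rightarrow> 'a) \<Rightarrow> 'a \<Rightarrow> real ^ 'n \<Rightarrow> real ^ 'n" where
  "differential A f p =
     frechet_derivative (snd (chart_at A (f p)) \<circ> f \<circ> chart_inv (chart_at A p)) (at (coords_at A p))"

text \<open>A vector field assigns to each point \<open>p\<close> a tangent vector at \<open>p\<close>.\<close>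

type_synonym ('a, 'n) vfield = "'a \<Rightarrow> real ^ 'n"

text \<open>The components of a vector field in an arbitrary chart \<open>c\<close>, as a function on the image of
  \<open>c\<close>: the differential of the change of coordinates is applied.\<close>

definition field_in_chart ::
  "('a, 'n::finite) chart set \<Rightarrow> ('a, 'n) chart \<Rightarrow> ('a, 'n) vfield \<Rightarrow> real ^ 'n \<Rightarrow> real ^ 'n" where
  "field_in_chart A c X x =
     (let p = chart_inv c x
      in frechet_derivative (snd c \<circ> chart_inv (chart_at A p)) (at (coords_at A p)) (X p))"

definition smooth_field :: "('a, 'n::finite) chart set \<Rightarrow> ('a, 'n) vfield \<Rightarrow> bool" where
  "smooth_field A X \<longleftrightarrow> (\<forall>c\<in>A. smooth_on (chart_image c) (field_in_chart A c X))"

text \<open>The derivative \<open>X f\<close> of a function along a vector field.\<close>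

definition field_deriv ::
  "('a, 'n::finite) chart set \<Rightarrow> ('a, 'n) vfield \<Rightarrow> ('a \<Rightarrow> real) \<Rightarrow> 'a \<Rightarrow> real" where
  "field_deriv A X f p =
     frechet_derivative (f \<circ> chart_inv (chart_at A p)) (at (coords_at A p)) (X p)"

text \<open>The Lie bracket, with the sign for which \<open>[X, Y] f = X (Y f) - Y (X f)\<close>. At \<open>p\<close> it is
  evaluated in the reference chart at \<open>p\<close>, where the components of \<open>X\<close> and \<open>Y\<close> at the point
  \<open>p\<close> itself are \<open>X p\<close> and \<open>Y p\<close>.\<close>

definition lie_bracket ::
  "('a, 'n::finite) chart set \<Rightarrow> ('a, 'n) vfield \<Rightarrow> ('a, 'n) vfield \<Rightarrow> ('a, 'n) vfield" where
  "lie_bracket A X Y p =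
     frechet_derivative (field_in_chart A (chart_at A p) Y) (at (coords_at A p)) (X p)
   - frechet_derivative (field_in_chart A (chart_at A p) X) (at (coords_at A p)) (Y p)"


section \<open>Riemannian metrics and curvature\<close>

type_synonym ('a, 'n) metric = "'a \<Rightarrow> real ^ 'n \<Rightarrow> real ^ 'n \<Rightarrow> real"

definition riemannian_metric :: "('a, 'n::finite) chart set \<Rightarrow> ('a, 'n) metric \<Rightarrow> bool" where
  "riemannian_metric A g \<longleftrightarrow>
     (\<forall>p. bilinear (g p) \<and> (\<forall>v w. g p v w = g p w v) \<and> (\<forall>v. v \<noteq> 0 \<longrightarrow> g p v v > 0)) \<and>
     (\<forall>X Y. smooth_field A X \<longrightarrow> smooth_field A Y \<longrightarrow> smooth_fun A (\<lambda>p. g p (X p) (Y p)))"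

text \<open>\<open>D X Y\<close> stands for the covariant derivative of \<open>Y\<close> along \<open>X\<close>; only its values on smooth
  vector fields are meaningful.\<close>

definition affine_connection ::
  "('a, 'n::finite) chart set \<Rightarrow> (('a, 'n) vfield \<Rightarrow> ('a, 'n) vfield \<Rightarrow> ('a, 'n) vfield) \<Rightarrow> bool" where
  "affine_connection A D \<longleftrightarrow>
     (\<forall>X Y. smooth_field A X \<longrightarrow> smooth_field A Y \<longrightarrow> smooth_field A (D X Y)) \<and>
     (\<forall>X X' Y. smooth_field A X \<longrightarrow> smooth_field A X' \<longrightarrow> smooth_field A Y \<longrightarrow>
        D (\<lambda>p. X p + X' p) Y = (\<lambda>p. D X Y p + D X' Y p)) \<and>
     (\<forall>f X Y. smooth_fun A f \<longrightarrow> smooth_field A X \<longrightarrow> smooth_field A Y \<longrightarrow>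
        D (\<lambda>p. f p *\<^sub>R X p) Y = (\<lambda>p. f p *\<^sub>R D X Y p)) \<and>
     (\<forall>X Y Y'. smooth_field A X \<longrightarrow> smooth_field A Y \<longrightarrow> smooth_field A Y' \<longrightarrow>
        D X (\<lambda>p. Y p + Y' p) = (\<lambda>p. D X Y p + D X Y' p)) \<and>
     (\<forall>f X Y. smooth_fun A f \<longrightarrow> smooth_field A X \<longrightarrow> smooth_field A Y \<longrightarrow>
        D X (\<lambda>p. f p *\<^sub>R Y p) = (\<lambda>p. field_deriv A X f p *\<^sub>R Y p + f p *\<^sub>R D X Y p))"

definition levi_civita ::
  "('a, 'n::finite) chart set \<Rightarrow> ('a, 'n) metric \<Rightarrow>
   (('a, 'n) vfield \<Rightarrow> ('a, 'n) vfield \<Rightarrow> ('a, 'n) vfield) \<Rightarrow> bool" where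
  "levi_civita A g D \<longleftrightarrow>
     affine_connection A D \<and>
     (\<forall>X Y. smooth_field A X \<longrightarrow> smooth_field A Y \<longrightarrow>
        (\<forall>p. D X Y p - D Y X p = lie_bracket A X Y p)) \<and>
     (\<forall>X Y Z. smooth_field A X \<longrightarrow> smooth_field A Y \<longrightarrow> smooth_field A Z \<longrightarrow>
        (\<forall>p. field_deriv A X (\<lambda>q. g q (Y q) (Z q)) p
           = g p (D X Y p) (Z p) + g p (Y p) (D X Z p)))"

definition curvature ::
  "('a, 'n::finite) chart set \<Rightarrow> ('a, 'n) metric \<Rightarrow>
   (('a, 'n) vfield \<Rightarrow> ('a, 'n) vfield \<Rightarrow> ('a, 'n) vfield) \<Rightarrow>
   ('a, 'n) vfield \<Rightarrow> ('a, 'n) vfield \<Rightarrow> ('a, 'n) vfield \<Rightarrow> ('a, 'n) vfield \<Rightarrow> 'a \<Rightarrow> real" where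
  "curvature A g D X Y U V p =
     g p (D X (D Y U) p - D Y (D X U) p - D (lie_bracket A X Y) U p) (V p)"

text \<open>Tensor components at \<open>p\<close> with respect to vector fields \<open>e i\<close>, indexed by \<open>i :: 'n\<close>, whose
  values at \<open>p\<close> form a basis of the tangent space.\<close>

definition frame_at ::
  "('a, 'n::finite) chart set \<Rightarrow> ('n \<Rightarrow> ('a, 'n) vfield) \<Rightarrow> 'a \<Rightarrow> bool" where
  "frame_at A e p \<longleftrightarrow>
     (\<forall>i. smooth_field A (e i)) \<and> inj (\<lambda>i. e i p) \<and> independent (range (\<lambda>i. e i p))"

definition gram :: "('a, 'n::finite) metric \<Rightarrow> ('n \<Rightarrow> ('a, 'n) vfield) \<Rightarrow> 'a \<Rightarrow> real ^ 'n ^ 'n" where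
  "gram g e p = (\<chi> i j. g p (e i p) (e j p))"

definition curv_low ::
  "('a, 'n::finite) chart set \<Rightarrow> ('a, 'n) metric \<Rightarrow>
   (('a, 'n) vfield \<Rightarrow> ('a, 'n) vfield \<Rightarrow> ('a, 'n) vfield) \<Rightarrow> ('n \<Rightarrow> ('a, 'n) vfield) \<Rightarrow> 'a \<Rightarrow>
   'n \<Rightarrow> 'n \<Rightarrow> 'n \<Rightarrow> 'n \<Rightarrow> real" where
  "curv_low A g D e p i a b c = curvature A g D (e i) (e a) (e b) (e c) p"

text \<open>The components with the last three indices raised.\<close>

definition curv_up ::
  "('a, 'n::finite) chart set \<Rightarrow> ('a, 'n) metric \<Rightarrow>
   (('a, 'n) vfield \<Rightarrow> ('a, 'n) vfield \<Rightarrow> ('a, 'n) vfield) \<Rightarrow> ('n \<Rightarrow> ('a, 'n) vfield) \<Rightarrow> 'a \<Rightarrow>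
   'n \<Rightarrow> 'n \<Rightarrow> 'n \<Rightarrow> 'n \<Rightarrow> real" where
  "curv_up A g D e p j a b c =
     (let G = matrix_inv (gram g e p)
      in \<Sum>a'\<in>UNIV. \<Sum>b'\<in>UNIV. \<Sum>c'\<in>UNIV.
           G $ a $ a' * G $ b $ b' * G $ c $ c' * curv_low A g D e p j a' b' c')"

definition R_check ::
  "('a, 'n::finite) chart set \<Rightarrow> ('a, 'n) metric \<Rightarrow>
   (('a, 'n) vfield \<Rightarrow> ('a, 'n) vfield \<Rightarrow> ('a, 'n) vfield) \<Rightarrow> ('n \<Rightarrow> ('a, 'n) vfield) \<Rightarrow> 'a \<Rightarrow>
   'n \<Rightarrow> 'n \<Rightarrow> real" where
  "R_check A g D e p i j =
     (\<Sum>a\<in>UNIV. \<Sum>b\<in>UNIV. \<Sum>c\<in>UNIV. curv_low A g D e p i a b c * curv_up A g D e p j a b c)"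

definition R_norm_sq ::
  "('a, 'n::finite) chart set \<Rightarrow> ('a, 'n) metric \<Rightarrow>
   (('a, 'n) vfield \<Rightarrow> ('a, 'n) vfield \<Rightarrow> ('a, 'n) vfield) \<Rightarrow> ('n \<Rightarrow> ('a, 'n) vfield) \<Rightarrow> 'a \<Rightarrow> real" where
  "R_norm_sq A g D e p =
     (\<Sum>i\<in>UNIV. \<Sum>j\<in>UNIV. matrix_inv (gram g e p) $ i $ j * R_check A g D e p i j)"

text \<open>The Levi-Civita connection exists and is unique on smooth vector fields, so the quantifier
  over \<open>D\<close> only names it. The tensor equation is required at every point, in every frame; as both
  sides are tensors, one frame at each point would suffice, and every basis of a tangent space
  extends to global smooth vector fields.\<close>

definition weakly_einstein :: "('a, 'n::finite) chart set \<Rightarrow> ('a, 'n) metric \<Rightarrow> bool" where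
  "weakly_einstein A g \<longleftrightarrow>
     (\<exists>D. levi_civita A g D \<and>
        (\<forall>p e. frame_at A e p \<longrightarrow>
           (\<forall>i j. R_check A g D e p i j
                = R_norm_sq A g D e p / real CARD('n) * g p (e i p) (e j p))))"


section \<open>Lie groups\<close>

definition lie_group ::
  "('a::{t2_space,second_countable_topology}, 'n::finite) chart set \<Rightarrow>
   ('a \<Rightarrow> 'a \<Rightarrow> 'a) \<Rightarrow> 'a \<Rightarrow> ('a \<Rightarrow> 'a) \<Rightarrow> bool" where
  "lie_group A mul u iv \<longleftrightarrow>
     smooth_atlas A \<and> connected (UNIV :: 'a set) \<and> group mul u iv \<and>
     continuous_on UNIV (\<lambda>(p, q). mul p q) \<and> continuous_on UNIV iv \<and>
     (\<forall>c\<in>A. \<forall>d\<in>A. \<forall>k\<in>A.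
        smooth_on
          {(x, y). x \<in> chart_image c \<and> y \<in> chart_image d \<and> mul (chart_inv c x) (chart_inv d y) \<in> fst k}
          (\<lambda>(x, y). snd k (mul (chart_inv c x) (chart_inv d y)))) \<and>
     (\<forall>c\<in>A. \<forall>k\<in>A.
        smooth_on {x \<in> chart_image c. iv (chart_inv c x) \<in> fst k}
          (\<lambda>x. snd k (iv (chart_inv c x))))"

definition lie_algebra ::
  "('a, 'n::finite) chart set \<Rightarrow> ('a \<Rightarrow> 'a \<Rightarrow> 'a) \<Rightarrow> ('a, 'n) vfield set" where
  "lie_algebra A mul =
     {X. smooth_field A X \<and> (\<forall>h p. X (mul h p) = differential A (mul h) p (X p))}"

text \<open>The span of the brackets of elements of two linear spaces \<open>V\<close> and \<open>W\<close> of vector fields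
  (scalar factors can be absorbed into \<open>V\<close>).\<close>

definition bracket_span ::
  "('a, 'n::finite) chart set \<Rightarrow> ('a, 'n) vfield set \<Rightarrow> ('a, 'n) vfield set \<Rightarrow> ('a, 'n) vfield set" where
  "bracket_span A V W =
     {\<lambda>p. \<Sum>k<m. lie_bracket A (X k) (Y k) p | (m::nat) X Y. \<forall>k<m. X k \<in> V \<and> Y k \<in> W}"

definition nonabelian :: "('a, 'n::finite) chart set \<Rightarrow> ('a \<Rightarrow> 'a \<Rightarrow> 'a) \<Rightarrow> bool" where
  "nonabelian A mul \<longleftrightarrow>
     bracket_span A (lie_algebra A mul) (lie_algebra A mul) \<noteq> {\<lambda>p. 0}"

definition two_step_nilpotent :: "('a, 'n::finite) chart set \<Rightarrow> ('a \<Rightarrow> 'a \<Rightarrow> 'a) \<Rightarrow> bool" where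
  "two_step_nilpotent A mul \<longleftrightarrow>
     bracket_span A (lie_algebra A mul)
       (bracket_span A (lie_algebra A mul) (lie_algebra A mul)) = {\<lambda>p. 0}"

definition left_invariant_metric ::
  "('a, 'n::finite) chart set \<Rightarrow> ('a \<Rightarrow> 'a \<Rightarrow> 'a) \<Rightarrow> ('a, 'n) metric \<Rightarrow> bool" where
  "left_invariant_metric A mul g \<longleftrightarrow>
     riemannian_metric A g \<and>
     (\<forall>h p v w. g (mul h p) (differential A (mul h) p v) (differential A (mul h) p w) = g p v w)"

end

theory Submission
  imports Defs
begin

text \<open>Choose a basis of the Lie algebra that is orthonormal and adapted to the center, and let \<open>J\<^sub>k\<close> be
  the skew matrix of the \<open>k\<close>-th components of the brackets of basis vectors. By Koszul's formula the curvature is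
  quadratic in the \<open>J\<^sub>k\<close>. Contract the weakly Einstein equation, with factor \<open>\<lambda>\<close>, once with the Gram
  matrix of the \<open>J\<^sub>k\<close>, which lives on the center, and once with \<open>- \<Sum>J\<^sub>k\<^sup>2\<close>, which lives on the orthogonal
  complement of the center. Both tensors have the same trace, so \<open>\<lambda>\<close> cancels in the difference, and what remains
  is a vanishing sum of squares, among them the norms of \<open>(J\<^sub>b J\<^sub>d + J\<^sub>d J\<^sub>b) J\<^sub>a\<close>. Taking \<open>a = b = d\<close> gives
  \<open>J\<^sub>a\<^sup>3 = 0\<close>, hence \<open>J\<^sub>a = 0\<close> by skewness, and the group is abelian.\<close>

section \<open>Matrices and triple sums\<close>

text \<open>Both contractions come from one quadratic form: inserting a vector \<open>v\<close>
  twice, the equation says that the tensor \<open>\<Sum>i. v i * Riem i j k l\<close> has squared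
  norm \<lambda> times the squared length of \<open>v\<close>. The first tensor is the sum of the
  squares of the brackets of basis vectors, the second that of the columns of the
  \<open>J\<^sub>k\<close>; both families have total squared length
  \<open>\<Sum>(c i j k)\<^sup>2\<close>, which is the common trace. Neither contraction decides
  anything alone. Each, scaled by 16, equals the same quantity
  \<open>6 * \<Sum>nsq (J a ** W x y)\<close> plus a correction. On the center the correction is
  minus a sum of squares, on the complement plus a sum of squares, so equality makes both vanish.
  The algebra is about constants, while curvature is defined by vector fields whose components refer
  to a chart that changes from point to point. The link is that left-invariant fields are smooth and
  closed under the Lie bracket (by naturality of the bracket, hence by symmetry of second
  derivatives) and under the connection, with constant coefficients. The equation is then used only
  at the unit.\<close>

lemma inner_matrix_sum: "A \<bullet> B = (\<Sum>i\<in>UNIV. \<Sum>j\<in>UNIV. A$i$j * B$i$j)"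
  for A B :: "real^'n::finite^'m::finite"
  by (simp add: inner_vec_def)

lemma inner_transpose: "transpose A \<bullet> transpose B = A \<bullet> B"
  for A B :: "real^'n::finite^'m::finite"
  by (simp add: inner_matrix_sum transpose_def sum.swap[of "\<lambda>i j. A$i$j * B$i$j"])

lemma inner_matrix_mult_right: "(M ** K) \<bullet> N = M \<bullet> (N ** transpose K)"
  for M :: "real^'k::finite^'m::finite" and K :: "real^'n::finite^'k"
proof -
  have "(\<Sum>j\<in>UNIV. \<Sum>k\<in>UNIV. M$i$k * K$k$j * N$i$j) = (\<Sum>k\<in>UNIV. \<Sum>j\<in>UNIV. M$i$k * (N$i$j * K$k$j))" for i
    by (subst sum.swap) (simp add: mult_ac)
  then show ?thesis
    by (simp add: inner_matrix_sum matrix_matrix_mult_def transpose_def sum_distrib_left sum_distrib_right)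
qed

lemma matrix_mult_uminus: "A ** (- B) = - (A ** B)" "(- A) ** B = - (A ** B)"
  for A :: "real^'k::finite^'m::finite" and B :: "real^'n::finite^'k"
  by (simp_all add: vec_eq_iff matrix_matrix_mult_def sum_negf)

text \<open>Moving a skew factor across the inner product costs a sign, so
  \<open>nsq (K ** K)\<close> is minus the inner product of \<open>K\<close> with its cube, and
  \<open>nsq K\<close> is minus the trace of \<open>K ** K\<close>.\<close>

lemma skew_cube_eq_0:
  fixes K :: "real^'n::finite^'n"
  assumes skew: "transpose K = - K" and cube: "K ** K ** K = 0"
  shows "K = 0"
proof -
  have m: "(M ** K) \<bullet> N = - (M \<bullet> (N ** K))" for M N :: "real^'n^'n"
    by (simp add: inner_matrix_mult_right skew matrix_mult_uminus)
  have "(K ** K) \<bullet> (K ** K) = - (K \<bullet> (K ** K ** K))"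
    by (rule m)
  then have sq: "K ** K = 0" using cube by simp
  have "K \<bullet> K = (mat 1 ** K) \<bullet> K" by simp
  also have "\<dots> = - (mat 1 \<bullet> (K ** K))" by (rule m)
  finally show ?thesis using sq by simp
qed

section \<open>Reindexing of triple sums and squared Frobenius norms\<close>

lemma sum3_cycle: "(\<Sum>j\<in>UNIV. \<Sum>k\<in>UNIV. \<Sum>l\<in>UNIV. f j k l) = (\<Sum>j\<in>UNIV. \<Sum>k\<in>UNIV. \<Sum>l\<in>UNIV. f k l j)"
  for f :: "'a \<Rightarrow> 'b \<Rightarrow> 'c \<Rightarrow> 'd::comm_monoid_add"
proof -
  have "(\<Sum>j\<in>UNIV. \<Sum>k\<in>UNIV. \<Sum>l\<in>UNIV. f j k l) = (\<Sum>j\<in>UNIV. \<Sum>l\<in>UNIV. \<Sum>k\<in>UNIV. f j k l)"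
    by (intro sum.cong refl sum.swap)
  also have "\<dots> = (\<Sum>l\<in>UNIV. \<Sum>j\<in>UNIV. \<Sum>k\<in>UNIV. f j k l)"
    by (rule sum.swap)
  finally show ?thesis .
qed

lemma sum3_swap12: "(\<Sum>j\<in>UNIV. \<Sum>k\<in>UNIV. \<Sum>l\<in>UNIV. f j k l) = (\<Sum>k\<in>UNIV. \<Sum>j\<in>UNIV. \<Sum>l\<in>UNIV. f j k l)"
  for f :: "'a \<Rightarrow> 'b \<Rightarrow> 'c \<Rightarrow> 'd::comm_monoid_add"
  by (rule sum.swap)

lemma sum3_swap13: "(\<Sum>j\<in>UNIV. \<Sum>k\<in>UNIV. \<Sum>l\<in>UNIV. f j k l) = (\<Sum>l\<in>UNIV. \<Sum>k\<in>UNIV. \<Sum>j\<in>UNIV. f j k l)"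
  for f :: "'a \<Rightarrow> 'b \<Rightarrow> 'c \<Rightarrow> 'd::comm_monoid_add"
  by (subst sum3_cycle) (intro sum.cong refl sum.swap)

lemma sum3_rotate: "(\<Sum>j\<in>UNIV. \<Sum>k\<in>UNIV. \<Sum>l\<in>UNIV. f j k l) = (\<Sum>k\<in>UNIV. \<Sum>l\<in>UNIV. \<Sum>j\<in>UNIV. f j k l)"
  for f :: "'a \<Rightarrow> 'b \<Rightarrow> 'c \<Rightarrow> 'd::comm_monoid_add"
  by (simp only: sum3_cycle[of "\<lambda>k l j. f j k l"])

abbreviation nsq :: "real^'n::finite^'m::finite \<Rightarrow> real" where "nsq M \<equiv> M \<bullet> M"

lemma nsq_sum: "nsq M = (\<Sum>i\<in>UNIV. \<Sum>j\<in>UNIV. (M $ i $ j)\<^sup>2)"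
  by (simp add: inner_matrix_sum power2_eq_square)

lemma nsq_diff: "nsq (A - B) = nsq A + nsq B - 2 * (A \<bullet> B)"
  and nsq_add: "nsq (A + B) = nsq A + nsq B + 2 * (A \<bullet> B)"
  by (simp_all add: inner_diff inner_add inner_commute)

lemma sum_nsq_family:
  fixes M :: "'a \<Rightarrow> 'b \<Rightarrow> real^'n::finite^'m::finite"
  shows
  "(\<Sum>m\<in>UNIV. \<Sum>j\<in>UNIV. \<Sum>k\<in>UNIV. \<Sum>l\<in>UNIV. (M k l $ j $ m)\<^sup>2) = (\<Sum>k\<in>UNIV. \<Sum>l\<in>UNIV. nsq (M k l))"
proof -
  have "(\<Sum>m\<in>UNIV. \<Sum>j\<in>UNIV. \<Sum>k\<in>UNIV. \<Sum>l\<in>UNIV. (M k l $ j $ m)\<^sup>2)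
     = (\<Sum>m\<in>UNIV. \<Sum>k\<in>UNIV. \<Sum>l\<in>UNIV. \<Sum>j\<in>UNIV. (M k l $ j $ m)\<^sup>2)"
    by (rule sum.cong[OF refl], rule sum3_rotate)
  also have "\<dots> = (\<Sum>k\<in>UNIV. \<Sum>l\<in>UNIV. \<Sum>m\<in>UNIV. \<Sum>j\<in>UNIV. (M k l $ j $ m)\<^sup>2)"
    by (rule sum3_rotate)
  also have "\<dots> = (\<Sum>k\<in>UNIV. \<Sum>l\<in>UNIV. \<Sum>j\<in>UNIV. \<Sum>m\<in>UNIV. (M k l $ j $ m)\<^sup>2)"
    by (intro sum.cong refl sum.swap)
  finally show ?thesis by (simp add: nsq_sum)
qed

text \<open>After cyclic renaming the three squares contribute 1 + 1 + 4 = 6, and the three mixed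
  products contribute 2 - 4 - 4 = -6.\<close>

lemma sum_cyclic_square:
  fixes U :: "'n::finite \<Rightarrow> 'n \<Rightarrow> 'n \<Rightarrow> real"
  shows "(\<Sum>j\<in>UNIV. \<Sum>k\<in>UNIV. \<Sum>l\<in>UNIV. (U l j k + U k l j - 2 * U j k l)\<^sup>2)
    = 6 * (\<Sum>j\<in>UNIV. \<Sum>k\<in>UNIV. \<Sum>l\<in>UNIV. (U j k l)\<^sup>2)
      - 6 * (\<Sum>j\<in>UNIV. \<Sum>k\<in>UNIV. \<Sum>l\<in>UNIV. U j k l * U k l j)"
proof -
  have e: "(U l j k + U k l j - 2 * U j k l)\<^sup>2 = 4 * (U j k l)\<^sup>2 + (U k l j)\<^sup>2 + (U l j k)\<^sup>2
      - 4 * (U l j k * U j k l) - 4 * (U j k l * U k l j) + 2 * (U k l j * U l j k)" for j k l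
    by (simp add: power2_eq_square algebra_simps)
  have 1: "(\<Sum>j\<in>UNIV. \<Sum>k\<in>UNIV. \<Sum>l\<in>UNIV. f j k l) = (\<Sum>j\<in>UNIV. \<Sum>k\<in>UNIV. \<Sum>l\<in>UNIV. f l j k)"
    for f :: "'n::finite \<Rightarrow> 'n \<Rightarrow> 'n \<Rightarrow> real"
    by (subst sum3_cycle, subst sum3_cycle, rule refl)
  show ?thesis
    unfolding e sum.distrib sum_subtractf sum_distrib_left[symmetric]
    using sum3_cycle[of "\<lambda>j k l. (U j k l)\<^sup>2"] 1[of "\<lambda>j k l. (U j k l)\<^sup>2"]
      sum3_cycle[of "\<lambda>j k l. U j k l * U k l j"] 1[of "\<lambda>j k l. U j k l * U k l j"]
    by linarith
qed

section \<open>Curvature of a two-step nilpotent metric Lie algebra\<close>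

text \<open>The structure constants \<open>c i j k = \<langle>[e\<^sub>i, e\<^sub>j], e\<^sub>k\<rangle>\<close> in an orthonormal basis whose elements
  \<open>e\<^sub>i\<close> with \<open>i \<in> S\<close> span the center.\<close>

locale two_step_constants =
  fixes c :: "'n::finite \<Rightarrow> 'n \<Rightarrow> 'n \<Rightarrow> real" and S :: "'n set"
  assumes skew: "c i j k = - c j i k"
    and adapted: "c i j k \<noteq> 0 \<Longrightarrow> i \<notin> S \<and> k \<in> S"
begin

lemma c_nonzero: "c i j k \<noteq> 0 \<Longrightarrow> i \<notin> S \<and> j \<notin> S \<and> k \<in> S"
  using adapted[of i j k] adapted[of j i k] skew[of i j k] by auto

lemma c_zero: "i \<in> S \<Longrightarrow> c i j k = 0" "j \<in> S \<Longrightarrow> c i j k = 0" "k \<notin> S \<Longrightarrow> c i j k = 0"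
  using c_nonzero[of i j k] by auto

definition J :: "'n \<Rightarrow> real^'n^'n" where "J k = (\<chi> i j. c i j k)"

text \<open>\<open>W x y\<close> is the skew map \<open>J\<close> of the central vector \<open>[e\<^sub>x, e\<^sub>y]\<close>.\<close>

definition W :: "'n \<Rightarrow> 'n \<Rightarrow> real^'n^'n" where "W x y = (\<Sum>a\<in>UNIV. c x y a *\<^sub>R J a)"

text \<open>The \<open>k\<close>-th component of the covariant derivative of
  \<open>e\<^sub>j\<close> along \<open>e\<^sub>i\<close>, as given by Koszul's formula when inner
  products of basis fields are constant.\<close>

definition Christoffel :: "'n \<Rightarrow> 'n \<Rightarrow> 'n \<Rightarrow> real" where
  "Christoffel i j k = (c i j k - c j k i + c k i j) / 2"

definition Riem :: "'n \<Rightarrow> 'n \<Rightarrow> 'n \<Rightarrow> 'n \<Rightarrow> real" where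
  "Riem i j k l = (\<Sum>m\<in>UNIV. Christoffel j k m * Christoffel i m l
      - Christoffel i k m * Christoffel j m l - c i j m * Christoffel m k l)"

text \<open>The inner product of the brackets \<open>[e\<^sub>i, e\<^sub>j]\<close> and
  \<open>[e\<^sub>k, e\<^sub>l]\<close>.\<close>

definition Q :: "'n \<Rightarrow> 'n \<Rightarrow> 'n \<Rightarrow> 'n \<Rightarrow> real" where
  "Q i j k l = (\<Sum>a\<in>UNIV. c i j a * c k l a)"

definition E :: "'n \<Rightarrow> 'n \<Rightarrow> 'n \<Rightarrow> 'n \<Rightarrow> real" where
  "E a b i j = (J a ** J b) $ i $ j"

section \<open>Symmetries and vanishing of the structure constants\<close>

lemma J_nth [simp]: "J k $ i $ j = c i j k"
  by (simp add: J_def)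

lemma transpose_J: "transpose (J k) = - J k"
  by (simp add: vec_eq_iff transpose_def) (metis skew)

lemma transpose_W: "transpose (W x y) = - W x y"
  by (simp add: vec_eq_iff transpose_def W_def) (metis (no_types, lifting) skew mult_minus_right sum.cong sum_negf)

lemma W_nth: "W x y $ i $ j = Q x y i j"
  by (simp add: W_def Q_def)

lemma E_sum: "E a b i j = (\<Sum>m\<in>UNIV. c i m a * c m j b)"
  by (simp add: E_def matrix_matrix_mult_def)

lemma E_zero: "a \<notin> S \<Longrightarrow> E a b i j = 0" "b \<notin> S \<Longrightarrow> E a b i j = 0"
  "i \<in> S \<Longrightarrow> E a b i j = 0" "j \<in> S \<Longrightarrow> E a b i j = 0"
  by (simp_all add: E_sum c_zero)

lemma Q_zero: "i \<in> S \<Longrightarrow> Q i j k l = 0" "j \<in> S \<Longrightarrow> Q i j k l = 0"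
  "k \<in> S \<Longrightarrow> Q i j k l = 0" "l \<in> S \<Longrightarrow> Q i j k l = 0"
  by (simp_all add: Q_def c_zero)

text \<open>A bracket is central, so an index that is an output of one factor and an input of the
  other would lie both in \<open>S\<close> and outside it. This is two-step nilpotency, term by
  term.\<close>

lemma cc_zero: "c i j m * c m k l = 0" "c i j m * c k m l = 0"
  using c_zero(1,2)[of m] c_zero(3)[of m] by (cases "m \<in> S"; simp)+

text \<open>In a product of two Christoffel symbols only those terms survive in which the summed
  index is an output of both factors, giving a \<open>Q\<close>, or an input of both, giving an
  \<open>E\<close>.\<close>

lemma Riem_expand:
  "4 * Riem i j k l = 2 * Q i j k l + Q j k l i - Q i k l j
    + E j l k i + E j i k l + E k l j i + E k i j l
    - E i l k j - E i j k l - E k l i j - E k j i l"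
proof -
  have prod: "4 * ((x - y - z) / 2 * ((p + q + r) / 2)) = x*p + x*q + x*r - y*p - y*q - y*r - z*p - z*q - z*r"
    for x y z p q r :: real by (simp add: field_simps)
  have t: "4 * (Christoffel j k m * Christoffel i m l
      - Christoffel i k m * Christoffel j m l - c i j m * Christoffel m k l)
    = 2 * (c i j m * c k l m) + c j k m * c l i m - c i k m * c l j m
    - c k m j * c i m l - c k m j * c l m i - c j m k * c i m l - c j m k * c l m i
    + c k m i * c j m l + c k m i * c l m j + c i m k * c j m l + c i m k * c l m j" for m
  proof -
    \<comment> \<open>Skewness puts \<open>m\<close> into the second slot wherever it is an input,
      the form in which \<open>cc_zero(2)\<close> discards the mixed products.\<close>
    have C: "Christoffel j k m = (c j k m - c k m j - c j m k) / 2"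
      "Christoffel i k m = (c i k m - c k m i - c i m k) / 2"
      "Christoffel i m l = (c i m l + c l m i + c l i m) / 2"
      "Christoffel j m l = (c j m l + c l m j + c l j m) / 2"
      "Christoffel m k l = (- c k m l - c k l m + c l m k) / 2"
      using skew[of m j k] skew[of m i k] skew[of m l i] skew[of m l j] skew[of m k l]
      by (simp_all add: Christoffel_def)
    have "4 * (c i j m * Christoffel m k l) = - 2 * (c i j m * c k l m)"
    proof -
      have e: "4 * (x * ((- p - q + r) / 2)) = - 2 * (x*p) - 2 * (x*q) + 2 * (x*r)" for x p q r :: real
        by (simp add: field_simps)
      show ?thesis
        unfolding C e using cc_zero(2)[of i j m k l] cc_zero(2)[of i j m l k] by linarith
    qed
    moreover have "4 * (Christoffel j k m * Christoffel i m l) = c j k m * c l i m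
        - c k m j * c i m l - c k m j * c l m i - c j m k * c i m l - c j m k * c l m i"
      using cc_zero(2)[of j k m i l] cc_zero(2)[of j k m l i]
        cc_zero(2)[of l i m k j] cc_zero(2)[of l i m j k]
      unfolding C prod by (simp only: mult.commute[of _ "c l i m"])
    moreover have "4 * (Christoffel i k m * Christoffel j m l) = c i k m * c l j m
        - c k m i * c j m l - c k m i * c l m j - c i m k * c j m l - c i m k * c l m j"
      using cc_zero(2)[of i k m j l] cc_zero(2)[of i k m l j]
        cc_zero(2)[of l j m k i] cc_zero(2)[of l j m i k]
      unfolding C prod by (simp only: mult.commute[of _ "c l j m"])
    ultimately show ?thesis by (simp add: right_diff_distrib)
  qed
  have E': "E a b x y = - (\<Sum>m\<in>UNIV. c x m a * c y m b)" for a b x y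
    unfolding E_sum sum_negf[symmetric] by (intro sum.cong) (simp_all add: skew[of _ y])
  show ?thesis
    unfolding Riem_def sum_distrib_left t Q_def E'
    by (simp add: sum.distrib sum_subtractf sum_distrib_left)
qed

text \<open>A central vector has no brackets, so \<open>i\<close> can only occur as the index of a
  \<open>J\<close>.\<close>

lemma Riem_in: "i \<in> S \<Longrightarrow> 4 * Riem i j k l = (E j i k l - E i j k l) + E k i j l - E i l k j"
  by (simp add: Riem_expand E_zero Q_zero)

text \<open>Here \<open>J i\<close> vanishes, so \<open>i\<close> can only occur as an argument of a
  bracket.\<close>

lemma Riem_notin: "i \<notin> S \<Longrightarrow> 4 * Riem i j k l = (2 * Q i j k l + Q j k l i - Q i k l j)
    + (E k l j i - E k l i j) + E j l k i - E k j i l"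
  by (simp add: Riem_expand E_zero)

lemma mult_W_nth: "(M ** W x y) $ i $ j = (\<Sum>a\<in>UNIV. c x y a * (M ** J a) $ i $ j)"
proof -
  have "(M ** W x y) $ i $ j = (\<Sum>m\<in>UNIV. \<Sum>a\<in>UNIV. M$i$m * (c x y a * c m j a))"
    by (simp add: W_def matrix_matrix_mult_def sum_distrib_left)
  also have "\<dots> = (\<Sum>a\<in>UNIV. \<Sum>m\<in>UNIV. M$i$m * (c x y a * c m j a))"
    by (rule sum.swap)
  finally show ?thesis
    by (simp add: matrix_matrix_mult_def sum_distrib_left mult.left_commute)
qed

lemma W_mult_nth: "(W x y ** M) $ i $ j = (\<Sum>a\<in>UNIV. c x y a * (J a ** M) $ i $ j)"
proof -
  have "(W x y ** M) $ i $ j = (\<Sum>m\<in>UNIV. \<Sum>a\<in>UNIV. c x y a * c i m a * M$m$j)"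
    by (simp add: W_def matrix_matrix_mult_def sum_distrib_right)
  also have "\<dots> = (\<Sum>a\<in>UNIV. \<Sum>m\<in>UNIV. c x y a * c i m a * M$m$j)"
    by (rule sum.swap)
  finally show ?thesis
    by (simp add: matrix_matrix_mult_def sum_distrib_left mult.assoc)
qed

text \<open>In the contractions below, the summands of the curvature are supported on disjoint sets of
  index patterns (which indices lie in \<open>S\<close>), so that squares can be taken summand by summand.\<close>

lemma Riem_contract_in:
  "4 * (\<Sum>a\<in>UNIV. c x y a * Riem a j k l)
   = (J j ** W x y - W x y ** J j) $ k $ l + (J k ** W x y) $ j $ l - (W x y ** J l) $ k $ j"
proof -
  have "4 * (c x y a * Riem a j k l)
     = c x y a * (J j ** J a) $ k $ l - c x y a * (J a ** J j) $ k $ l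
       + c x y a * (J k ** J a) $ j $ l - c x y a * (J a ** J l) $ k $ j" for a
  \<comment> \<open>The factor \<open>c x y a\<close> vanishes for \<open>a\<close> outside
    \<open>S\<close>, so the curvature formula with a central index in the leading slot is
    enough.\<close>
  proof (cases "a \<in> S")
    case True
    have "4 * (c x y a * Riem a j k l) = c x y a * (4 * Riem a j k l)" by simp
    then show ?thesis unfolding Riem_in[OF True] E_def by (simp add: algebra_simps)
  qed (simp add: c_zero)
  then show ?thesis
    by (simp add: sum_distrib_left mult_W_nth W_mult_nth sum.distrib sum_subtractf)
qed

lemma J_zero: "k \<notin> S \<Longrightarrow> J k = 0"
  by (simp add: vec_eq_iff c_zero)

lemma J_mult_row_zero: "i \<in> S \<Longrightarrow> (J k ** M) $ i $ j = 0"
  by (simp add: matrix_matrix_mult_def c_zero)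

lemma J_mult_col_zero: "j \<in> S \<Longrightarrow> (M ** J k) $ i $ j = 0"
  by (simp add: matrix_matrix_mult_def c_zero)

lemma W_mult_row_zero: "i \<in> S \<Longrightarrow> (W x y ** M) $ i $ j = 0"
  by (simp add: matrix_matrix_mult_def W_nth Q_zero)

lemma W_mult_col_zero: "j \<in> S \<Longrightarrow> (M ** W x y) $ i $ j = 0"
  by (simp add: matrix_matrix_mult_def W_nth Q_zero)

text \<open>Each of the three summands needs exactly one index in \<open>S\<close>: \<open>j\<close>
  for the commutator, \<open>k\<close> and \<open>l\<close> for the other two. Hence all cross terms
  vanish.\<close>

lemma Riem_in_square:
  "(\<Sum>j\<in>UNIV. \<Sum>k\<in>UNIV. \<Sum>l\<in>UNIV. (4 * (\<Sum>a\<in>UNIV. c x y a * Riem a j k l))\<^sup>2)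
   = (\<Sum>b\<in>UNIV. nsq (J b ** W x y - W x y ** J b) + nsq (J b ** W x y) + nsq (W x y ** J b))"
proof -
  have "(4 * (\<Sum>a\<in>UNIV. c x y a * Riem a j k l))\<^sup>2
     = ((J j ** W x y - W x y ** J j) $ k $ l)\<^sup>2 + ((J k ** W x y) $ j $ l)\<^sup>2 + ((W x y ** J l) $ k $ j)\<^sup>2"
    for j k l
    unfolding Riem_contract_in
    by (cases "j \<in> S"; cases "k \<in> S"; cases "l \<in> S")
       (simp_all add: J_zero J_mult_row_zero J_mult_col_zero W_mult_row_zero W_mult_col_zero)
  then show ?thesis
    unfolding nsq_sum sum.distrib
    by (simp only: sum.distrib sum3_swap12[of "\<lambda>j k l. ((J k ** W x y) $ j $ l)\<^sup>2"]
          sum3_swap13[of "\<lambda>j k l. ((W x y ** J l) $ k $ j)\<^sup>2"])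
qed

section \<open>Contraction on the orthogonal complement of the center\<close>

lemma E_transpose: "E a b i j = E b a j i"
  unfolding E_sum by (intro sum.cong refl) (metis skew minus_mult_minus mult.commute)

lemma J_mult_J_nth: "(\<Sum>i\<in>UNIV. c i m a * E p q j i) = (J p ** J q ** J a) $ j $ m"
  by (simp add: matrix_matrix_mult_def[of "J p ** J q"] E_def mult.commute)

lemma Riem_contract_notin:
  "4 * (\<Sum>i\<in>UNIV. c i m a * Riem i j k l)
   = ((J a ** W j k) $ m $ l + (J a ** W l j) $ m $ k - 2 * (J a ** W k l) $ m $ j)
     + (J k ** J l ** J a - J l ** J k ** J a) $ j $ m + (J j ** J l ** J a) $ k $ m
     - (J j ** J k ** J a) $ l $ m"
proof -
  have U: "(\<Sum>i\<in>UNIV. c i m a * Q i x y z) = - (J a ** W y z) $ m $ x" for x y z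
  proof -
    have "c i m a * Q i x y z = - (c m i a * Q y z i x)" for i
      using skew[of i m a] by (simp add: Q_def mult.commute)
    then show ?thesis by (simp add: matrix_matrix_mult_def W_nth sum_negf)
  qed
  \<comment> \<open>To be summed against \<open>c i m a\<close>, every \<open>Q\<close> gets
    \<open>i\<close> as its leading index and, by \<open>E_transpose\<close>, every \<open>E\<close>
    gets it as its last.\<close>
  have Qs: "Q j k l i = - Q i l j k" for i
    unfolding Q_def sum_negf[symmetric] by (intro sum.cong refl) (simp add: skew[of l i])
  have "4 * (c i m a * Riem i j k l)
     = 2 * (c i m a * Q i j k l) - c i m a * Q i l j k - c i m a * Q i k l j
       + c i m a * E k l j i - c i m a * E l k j i + c i m a * E j l k i - c i m a * E j k l i" for i
  proof (cases "i \<in> S")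
    case False
    have "4 * (c i m a * Riem i j k l) = c i m a * (4 * Riem i j k l)" by simp
    then show ?thesis unfolding Riem_notin[OF False] Qs E_transpose[of k l i j] E_transpose[of k j i l]
      by (simp add: algebra_simps)
  qed (simp add: c_zero)
  then have "4 * (\<Sum>i\<in>UNIV. c i m a * Riem i j k l) = 2 * (\<Sum>i\<in>UNIV. c i m a * Q i j k l)
      - (\<Sum>i\<in>UNIV. c i m a * Q i l j k) - (\<Sum>i\<in>UNIV. c i m a * Q i k l j)
      + (\<Sum>i\<in>UNIV. c i m a * E k l j i) - (\<Sum>i\<in>UNIV. c i m a * E l k j i)
      + (\<Sum>i\<in>UNIV. c i m a * E j l k i) - (\<Sum>i\<in>UNIV. c i m a * E j k l i)"
    by (simp add: sum_distrib_left sum.distrib sum_subtractf)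
  then show ?thesis
    by (simp add: U J_mult_J_nth)
qed

text \<open>The four summands live on disjoint patterns: no index in \<open>S\<close>, or exactly
  \<open>k, l\<close>, or exactly \<open>j, l\<close>, or exactly \<open>j, k\<close>. The pattern
  without central indices is the cyclic expression of \<open>sum_cyclic_square\<close>; the last two
  patterns give equal sums after renaming.\<close>

lemma Riem_notin_square:
  "(\<Sum>j\<in>UNIV. \<Sum>k\<in>UNIV. \<Sum>l\<in>UNIV. (4 * (\<Sum>i\<in>UNIV. c i m a * Riem i j k l))\<^sup>2)
   = 6 * (\<Sum>j\<in>UNIV. \<Sum>k\<in>UNIV. \<Sum>l\<in>UNIV. ((J a ** W k l) $ m $ j)\<^sup>2)
     - 6 * (\<Sum>j\<in>UNIV. \<Sum>k\<in>UNIV. \<Sum>l\<in>UNIV. (J a ** W k l) $ m $ j * (J a ** W l j) $ m $ k)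
     + (\<Sum>j\<in>UNIV. \<Sum>k\<in>UNIV. \<Sum>l\<in>UNIV. ((J k ** J l ** J a - J l ** J k ** J a) $ j $ m)\<^sup>2)
     + 2 * (\<Sum>j\<in>UNIV. \<Sum>k\<in>UNIV. \<Sum>l\<in>UNIV. ((J k ** J l ** J a) $ j $ m)\<^sup>2)"
proof -
  have W0: "W x y = 0" if "x \<in> S \<or> y \<in> S" for x y
    using that by (auto simp: vec_eq_iff W_nth Q_zero)
  have "(4 * (\<Sum>i\<in>UNIV. c i m a * Riem i j k l))\<^sup>2
     = ((J a ** W j k) $ m $ l + (J a ** W l j) $ m $ k - 2 * (J a ** W k l) $ m $ j)\<^sup>2
       + ((J k ** J l ** J a - J l ** J k ** J a) $ j $ m)\<^sup>2 + ((J j ** J l ** J a) $ k $ m)\<^sup>2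
       + ((J j ** J k ** J a) $ l $ m)\<^sup>2"
    for j k l
    unfolding Riem_contract_notin
    by (cases "j \<in> S"; cases "k \<in> S"; cases "l \<in> S")
       (simp_all add: J_zero J_mult_row_zero W_mult_col_zero W0 matrix_mul_assoc[symmetric])
  moreover have "(\<Sum>j\<in>UNIV. \<Sum>k\<in>UNIV. \<Sum>l\<in>UNIV. ((J j ** J k ** J a) $ l $ m)\<^sup>2)
     = (\<Sum>j\<in>UNIV. \<Sum>k\<in>UNIV. \<Sum>l\<in>UNIV. ((J k ** J l ** J a) $ j $ m)\<^sup>2)"
    by (rule sum3_cycle)
  moreover have "(\<Sum>j\<in>UNIV. \<Sum>k\<in>UNIV. \<Sum>l\<in>UNIV. ((J j ** J l ** J a) $ k $ m)\<^sup>2)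
     = (\<Sum>j\<in>UNIV. \<Sum>k\<in>UNIV. \<Sum>l\<in>UNIV. ((J k ** J l ** J a) $ j $ m)\<^sup>2)"
    by (rule sum3_swap12)
  ultimately show ?thesis
    using sum_cyclic_square[of "\<lambda>j k l. (J a ** W k l) $ m $ j"]
    by (simp only: sum.distrib)
qed

section \<open>Evaluation of the two contractions as norms of matrix products\<close>

lemma sum_nsq_J_W:
  "(\<Sum>m\<in>UNIV. \<Sum>j\<in>UNIV. \<Sum>k\<in>UNIV. \<Sum>l\<in>UNIV. ((J a ** W k l) $ m $ j)\<^sup>2)
   = (\<Sum>k\<in>UNIV. \<Sum>l\<in>UNIV. nsq (J a ** W k l))"
proof -
  have "(\<Sum>m\<in>UNIV. \<Sum>j\<in>UNIV. \<Sum>k\<in>UNIV. \<Sum>l\<in>UNIV. ((J a ** W k l) $ m $ j)\<^sup>2)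
     = (\<Sum>m\<in>UNIV. \<Sum>k\<in>UNIV. \<Sum>l\<in>UNIV. \<Sum>j\<in>UNIV. ((J a ** W k l) $ m $ j)\<^sup>2)"
    by (rule sum.cong[OF refl], rule sum3_rotate)
  also have "\<dots> = (\<Sum>k\<in>UNIV. \<Sum>l\<in>UNIV. \<Sum>m\<in>UNIV. \<Sum>j\<in>UNIV. ((J a ** W k l) $ m $ j)\<^sup>2)"
    by (rule sum3_rotate)
  finally show ?thesis by (simp add: nsq_sum)
qed

lemma inner_mult_J: "(M ** J k) \<bullet> N = - (M \<bullet> (N ** J k))"
  by (simp add: inner_matrix_mult_right transpose_J matrix_mult_uminus)

lemma inner_transpose_J3: "(J a ** J b ** J d) \<bullet> (J a ** J d ** J b) = (J d ** J b ** J a) \<bullet> (J b ** J d ** J a)"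
  by (subst inner_transpose[symmetric])
     (simp add: matrix_transpose_mul transpose_J matrix_mult_uminus matrix_mul_assoc)

text \<open>This turns a mixed sum of \<open>W\<close> into products of three \<open>J\<close>, the
  only terms with which it can combine. Expanding both \<open>W\<close>, the sum over
  \<open>l\<close> builds \<open>J b ** J d\<close>, and the sum over \<open>k\<close> then builds
  \<open>J a ** J d ** J b ** J d\<close>.\<close>

lemma sum_cross_J_W:
  "(\<Sum>m\<in>UNIV. \<Sum>j\<in>UNIV. \<Sum>k\<in>UNIV. \<Sum>l\<in>UNIV. (J a ** W k l) $ m $ j * (J a ** W l j) $ m $ k)
   = - (\<Sum>b\<in>UNIV. \<Sum>d\<in>UNIV. (J d ** J b ** J a) \<bullet> (J b ** J d ** J a))" (is "?L = _")
proof -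
  have JJ: "(\<Sum>l\<in>UNIV. c k l b * c l j d) = (J b ** J d) $ k $ j" for k j b d
    by (simp add: matrix_matrix_mult_def)
  have 1: "(\<Sum>l\<in>UNIV. (J a ** W k l) $ m $ j * (J a ** W l j) $ m $ k)
      = (\<Sum>b\<in>UNIV. \<Sum>d\<in>UNIV. (J a ** J b) $ m $ j * (J a ** J d) $ m $ k * (J b ** J d) $ k $ j)" for m j k
  proof -
    have "(\<Sum>l\<in>UNIV. (J a ** W k l) $ m $ j * (J a ** W l j) $ m $ k)
      = (\<Sum>l\<in>UNIV. \<Sum>b\<in>UNIV. \<Sum>d\<in>UNIV. (J a ** J b) $ m $ j * (J a ** J d) $ m $ k * (c k l b * c l j d))"
      unfolding mult_W_nth sum_product by (intro sum.cong refl) (simp add: mult_ac)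
    also have "\<dots> = (\<Sum>b\<in>UNIV. \<Sum>d\<in>UNIV. \<Sum>l\<in>UNIV. (J a ** J b) $ m $ j * (J a ** J d) $ m $ k * (c k l b * c l j d))"
      by (rule sum3_rotate)
    finally show ?thesis by (simp only: sum_distrib_left[symmetric] JJ)
  qed
  have "?L = (\<Sum>m\<in>UNIV. \<Sum>j\<in>UNIV. \<Sum>b\<in>UNIV. \<Sum>d\<in>UNIV. \<Sum>k\<in>UNIV. (J a ** J b) $ m $ j * (J a ** J d) $ m $ k * (J b ** J d) $ k $ j)"
    unfolding 1 by (rule sum.cong[OF refl], rule sum.cong[OF refl], rule sum3_rotate)
  also have "\<dots> = (\<Sum>m\<in>UNIV. \<Sum>j\<in>UNIV. \<Sum>b\<in>UNIV. \<Sum>d\<in>UNIV. (J a ** J b) $ m $ j * (J a ** J d ** (J b ** J d)) $ m $ j)"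
    unfolding matrix_matrix_mult_def[of "J a ** J d" "J b ** J d" for d b]
    by (simp add: sum_distrib_left mult.assoc)
  also have "\<dots> = (\<Sum>m\<in>UNIV. \<Sum>b\<in>UNIV. \<Sum>d\<in>UNIV. \<Sum>j\<in>UNIV. (J a ** J b) $ m $ j * (J a ** J d ** (J b ** J d)) $ m $ j)"
    by (rule sum.cong[OF refl], rule sum3_rotate)
  also have "\<dots> = (\<Sum>b\<in>UNIV. \<Sum>d\<in>UNIV. \<Sum>m\<in>UNIV. \<Sum>j\<in>UNIV. (J a ** J b) $ m $ j * (J a ** J d ** (J b ** J d)) $ m $ j)"
    by (rule sum3_rotate)
  also have "\<dots> = (\<Sum>b\<in>UNIV. \<Sum>d\<in>UNIV. (J a ** J b) \<bullet> (J a ** J d ** J b ** J d))"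
    by (simp only: inner_matrix_sum matrix_mul_assoc)
  also have "\<dots> = (\<Sum>b\<in>UNIV. \<Sum>d\<in>UNIV. - ((J d ** J b ** J a) \<bullet> (J b ** J d ** J a)))"
  proof -
    \<comment> \<open>The last \<open>J d\<close> moves across with a sign; transposition then
      reverses the order of the factors, its three signs on each side cancelling.\<close>
    have "(J a ** J b) \<bullet> (J a ** J d ** J b ** J d) = - ((J d ** J b ** J a) \<bullet> (J b ** J d ** J a))" for b d
      using inner_mult_J[of "J a ** J d ** J b" d "J a ** J b"] inner_transpose_J3[of a d b]
      by (simp only: inner_commute)
    then show ?thesis by simp
  qed
  finally show ?thesis by (simp add: sum_negf)
qed

lemma nsq_W_J: "nsq (W x y ** J b) = nsq (J b ** W x y)"
  by (subst inner_transpose[symmetric])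
     (simp add: matrix_transpose_mul transpose_J transpose_W matrix_mult_uminus)

text \<open>The parallelogram law, with both products of equal norm, replaces the commutator by the
  anticommutator: \<open>nsq (X - Y) = 4 * nsq X - nsq (X + Y)\<close>.\<close>

lemma contraction_in:
  "(\<Sum>x\<in>UNIV. \<Sum>y\<in>UNIV. \<Sum>j\<in>UNIV. \<Sum>k\<in>UNIV. \<Sum>l\<in>UNIV. (4 * (\<Sum>a\<in>UNIV. c x y a * Riem a j k l))\<^sup>2)
   = 6 * (\<Sum>a\<in>UNIV. \<Sum>x\<in>UNIV. \<Sum>y\<in>UNIV. nsq (J a ** W x y))
     - (\<Sum>a\<in>UNIV. \<Sum>x\<in>UNIV. \<Sum>y\<in>UNIV. nsq (J a ** W x y + W x y ** J a))"
proof -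
  have "nsq (J b ** W x y - W x y ** J b) + nsq (J b ** W x y) + nsq (W x y ** J b)
      = 6 * nsq (J b ** W x y) - nsq (J b ** W x y + W x y ** J b)" for b x y
    by (simp add: nsq_diff nsq_add nsq_W_J)
  then show ?thesis
    unfolding Riem_in_square
    using sum3_rotate[of "\<lambda>b x y. nsq (J b ** W x y)"]
      sum3_rotate[of "\<lambda>b x y. nsq (J b ** W x y + W x y ** J b)"]
    by (simp only: sum_subtractf sum_distrib_left[symmetric])
qed

text \<open>With \<open>?G\<close> and \<open>?D\<close> from the proof, the terms in three
  \<open>J\<close> add up to \<open>6 * ?D + (2 * ?G - 2 * ?D) + 2 * ?G = 4 * (?G + ?D)\<close>,
  which is twice the sum of squared norms of the symmetrized products.\<close>

lemma contraction_notin: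
  "(\<Sum>a\<in>UNIV. \<Sum>m\<in>UNIV. \<Sum>j\<in>UNIV. \<Sum>k\<in>UNIV. \<Sum>l\<in>UNIV. (4 * (\<Sum>i\<in>UNIV. c i m a * Riem i j k l))\<^sup>2)
   = 6 * (\<Sum>a\<in>UNIV. \<Sum>x\<in>UNIV. \<Sum>y\<in>UNIV. nsq (J a ** W x y))
     + 2 * (\<Sum>a\<in>UNIV. \<Sum>b\<in>UNIV. \<Sum>d\<in>UNIV. nsq (J b ** J d ** J a + J d ** J b ** J a))"
proof -
  have "(\<Sum>m\<in>UNIV. \<Sum>j\<in>UNIV. \<Sum>k\<in>UNIV. \<Sum>l\<in>UNIV. (4 * (\<Sum>i\<in>UNIV. c i m a * Riem i j k l))\<^sup>2)
    = 6 * (\<Sum>x\<in>UNIV. \<Sum>y\<in>UNIV. nsq (J a ** W x y))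
      + 2 * (\<Sum>b\<in>UNIV. \<Sum>d\<in>UNIV. nsq (J b ** J d ** J a + J d ** J b ** J a))" for a
  proof -
    let ?G = "\<Sum>b\<in>UNIV. \<Sum>d\<in>UNIV. nsq (J b ** J d ** J a)"
    let ?D = "\<Sum>b\<in>UNIV. \<Sum>d\<in>UNIV. (J d ** J b ** J a) \<bullet> (J b ** J d ** J a)"
    have G: "(\<Sum>b\<in>UNIV. \<Sum>d\<in>UNIV. nsq (J d ** J b ** J a)) = ?G"
      by (rule sum.swap)
    have D: "(\<Sum>b\<in>UNIV. \<Sum>d\<in>UNIV. (J b ** J d ** J a) \<bullet> (J d ** J b ** J a)) = ?D"
      by (rule sum.swap)
    have "(\<Sum>b\<in>UNIV. \<Sum>d\<in>UNIV. nsq (J b ** J d ** J a - J d ** J b ** J a)) = 2 * ?G - 2 * ?D"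
      unfolding nsq_diff sum_subtractf sum.distrib sum_distrib_left[symmetric] G D by simp
    moreover have "(\<Sum>b\<in>UNIV. \<Sum>d\<in>UNIV. nsq (J b ** J d ** J a + J d ** J b ** J a)) = 2 * ?G + 2 * ?D"
      unfolding nsq_add sum.distrib sum_distrib_left[symmetric] G D by simp
    ultimately show ?thesis
      unfolding Riem_notin_square sum.distrib sum_subtractf sum_distrib_left[symmetric]
        sum_nsq_J_W sum_cross_J_W sum_nsq_family by simp
  qed
  then show ?thesis by (simp only: sum.distrib sum_distrib_left[symmetric])
qed

lemma weakly_einstein_imp_zero:
  assumes we: "\<And>i i'. (\<Sum>j\<in>UNIV. \<Sum>k\<in>UNIV. \<Sum>l\<in>UNIV. Riem i j k l * Riem i' j k l) = (if i = i' then r else 0)"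
  shows "c i j k = 0"
proof -
  \<comment> \<open>The equation as a quadratic form in \<open>v\<close>; it is applied to
    \<open>v i = c x y i\<close> and to \<open>v i = c i m a\<close>.\<close>
  have sq: "(\<Sum>j\<in>UNIV. \<Sum>k\<in>UNIV. \<Sum>l\<in>UNIV. (4 * (\<Sum>i\<in>UNIV. v i * Riem i j k l))\<^sup>2)
      = 16 * r * (\<Sum>i\<in>UNIV. (v i)\<^sup>2)" for v
  proof -
    have "(\<Sum>j\<in>UNIV. \<Sum>k\<in>UNIV. \<Sum>l\<in>UNIV. (4 * (\<Sum>i\<in>UNIV. v i * Riem i j k l))\<^sup>2)
      = 16 * (\<Sum>j\<in>UNIV. \<Sum>k\<in>UNIV. \<Sum>l\<in>UNIV. \<Sum>i\<in>UNIV. \<Sum>i'\<in>UNIV. v i * v i' * (Riem i j k l * Riem i' j k l))"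
      by (simp add: power_mult_distrib power2_eq_square sum_product sum_distrib_left mult_ac)
    also have "\<dots> = 16 * (\<Sum>j\<in>UNIV. \<Sum>k\<in>UNIV. \<Sum>i\<in>UNIV. \<Sum>i'\<in>UNIV. \<Sum>l\<in>UNIV. v i * v i' * (Riem i j k l * Riem i' j k l))"
      by (rule arg_cong[where f = "(*) 16"], rule sum.cong[OF refl], rule sum.cong[OF refl], rule sum3_rotate)
    also have "\<dots> = 16 * (\<Sum>j\<in>UNIV. \<Sum>i\<in>UNIV. \<Sum>i'\<in>UNIV. \<Sum>k\<in>UNIV. \<Sum>l\<in>UNIV. v i * v i' * (Riem i j k l * Riem i' j k l))"
      by (rule arg_cong[where f = "(*) 16"], rule sum.cong[OF refl], rule sum3_rotate)
    also have "\<dots> = 16 * (\<Sum>i\<in>UNIV. \<Sum>i'\<in>UNIV. \<Sum>j\<in>UNIV. \<Sum>k\<in>UNIV. \<Sum>l\<in>UNIV. v i * v i' * (Riem i j k l * Riem i' j k l))"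
      by (rule arg_cong[where f = "(*) 16"], rule sum3_rotate)
    also have "\<dots> = 16 * (\<Sum>i\<in>UNIV. \<Sum>i'\<in>UNIV. if i = i' then r * (v i)\<^sup>2 else 0)"
      by (simp only: sum_distrib_left[symmetric] we) (simp add: if_distrib[of "(*) _"] power2_eq_square mult_ac cong: if_cong)
    finally show ?thesis by (simp add: sum_distrib_left mult_ac)
  qed
  \<comment> \<open>The two families of vectors have the same total squared length, so the unknown
    \<open>r\<close> drops out of the difference.\<close>
  have "(\<Sum>x\<in>UNIV. \<Sum>y\<in>UNIV. \<Sum>a\<in>UNIV. (c x y a)\<^sup>2) = (\<Sum>a\<in>UNIV. \<Sum>m\<in>UNIV. \<Sum>i\<in>UNIV. (c i m a)\<^sup>2)"
    by (rule sum3_swap13)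
  then have "(\<Sum>a\<in>UNIV. \<Sum>x\<in>UNIV. \<Sum>y\<in>UNIV. nsq (J a ** W x y + W x y ** J a))
     + 2 * (\<Sum>a\<in>UNIV. \<Sum>b\<in>UNIV. \<Sum>d\<in>UNIV. nsq (J b ** J d ** J a + J d ** J b ** J a)) = 0"
    using contraction_in contraction_notin unfolding sq sum_distrib_left[symmetric] by simp
  moreover have "(\<Sum>a\<in>UNIV. \<Sum>x\<in>UNIV. \<Sum>y\<in>UNIV. nsq (J a ** W x y + W x y ** J a)) \<ge> 0"
    by (intro sum_nonneg inner_ge_zero)
  moreover have nn: "(\<Sum>a\<in>UNIV. \<Sum>b\<in>UNIV. \<Sum>d\<in>UNIV. nsq (J b ** J d ** J a + J d ** J b ** J a)) \<ge> 0"
    by (intro sum_nonneg inner_ge_zero)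
  ultimately have "(\<Sum>a\<in>UNIV. \<Sum>b\<in>UNIV. \<Sum>d\<in>UNIV. nsq (J b ** J d ** J a + J d ** J b ** J a)) = 0"
    by linarith
  then have "\<forall>a b d. nsq (J b ** J d ** J a + J d ** J b ** J a) = 0"
    by (simp add: sum_nonneg_eq_0_iff sum_nonneg del: inner_eq_zero_iff)
  then have "nsq (J k ** J k ** J k + J k ** J k ** J k) = 0"
    by blast
  then have "J k ** J k ** J k = 0"
    by (simp add: scaleR_2[symmetric])
  then have "J k = 0"
    by (rule skew_cube_eq_0[OF transpose_J])
  then show ?thesis using J_nth[of k i j] by simp
qed

end

section \<open>Smooth maps and symmetry of second derivatives\<close>

lemma frechet_derivative_cong_open:
  assumes "open S" "x \<in> S" "\<And>y. y \<in> S \<Longrightarrow> f y = g y"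
  shows "frechet_derivative f (at x) = frechet_derivative g (at x)"
proof -
  have "(f has_derivative D) (at x) \<longleftrightarrow> (g has_derivative D) (at x)" for D
    using has_derivative_transform_within_open[of f D x UNIV S g]
      has_derivative_transform_within_open[of g D x UNIV S f] assms by auto
  then show ?thesis unfolding frechet_derivative_def by simp
qed

lemma differentiable_cong_open:
  assumes "open S" "x \<in> S" "\<And>y. y \<in> S \<Longrightarrow> f y = g y"
  shows "f differentiable at x \<longleftrightarrow> g differentiable at x"
proof -
  have "(f has_derivative D) (at x) \<longleftrightarrow> (g has_derivative D) (at x)" for D
    using has_derivative_transform_within_open[of f D x UNIV S g]
      has_derivative_transform_within_open[of g D x UNIV S f] assms by auto
  then show ?thesis unfolding differentiable_def by simp
qed

lemma frechet_derivativeI: "(f has_derivative f') (at x) \<Longrightarrow> frechet_derivative f (at x) = f'"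
  by (metis frechet_derivative_at)

lemma Ck_on_cong:
  assumes "open S" "\<And>x. x \<in> S \<Longrightarrow> f x = g x"
  shows "Ck_on k S f \<longleftrightarrow> Ck_on k S g"
  using assms(2)
proof (induction k arbitrary: f g)
  case 0
  then show ?case by (simp cong: continuous_on_cong)
next
  case (Suc k)
  have "Ck_on k S (\<lambda>x. frechet_derivative f (at x) v) \<longleftrightarrow> Ck_on k S (\<lambda>x. frechet_derivative g (at x) v)" for v
    by (rule Suc.IH) (simp add: frechet_derivative_cong_open[OF assms(1) _ Suc.prems])
  moreover have "f differentiable at x \<longleftrightarrow> g differentiable at x" if "x \<in> S" for x
    by (rule differentiable_cong_open[OF assms(1) that Suc.prems])
  ultimately show ?case by simp
qed

lemma Ck_on_const: "Ck_on k S (\<lambda>x. a)"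
  by (induction k arbitrary: a) simp_all

text \<open>The derivative of the composite in direction \<open>v\<close> is the derivative of
  \<open>f\<close> in direction \<open>L v\<close>, composed with the same affine map, so the
  induction on \<open>k\<close> closes without a higher chain rule. The use is in freezing one
  argument of a map of two variables.\<close>

lemma Ck_on_affine:
  assumes "open S" "bounded_linear L" "Ck_on k S f"
  shows "Ck_on k {x. a + L x \<in> S} (\<lambda>x. f (a + L x))"
  using assms(3)
proof (induction k arbitrary: f)
  case 0
  have "continuous_on {x. a + L x \<in> S} (\<lambda>x. a + L x)"
    by (intro continuous_intros bounded_linear.continuous_on[OF assms(2)])
  then have "continuous_on {x. a + L x \<in> S} (f \<circ> (\<lambda>x. a + L x))"
    using 0 by (intro continuous_on_compose) (auto elim: continuous_on_subset)
  then show ?case by (simp add: o_def)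
next
  case (Suc k)
  have op: "open {x. a + L x \<in> S}"
  proof -
    have "continuous_on UNIV (\<lambda>x. a + L x)"
      by (intro continuous_intros bounded_linear.continuous_on[OF assms(2)])
    from open_vimage[OF assms(1) this] show ?thesis by (simp add: vimage_def)
  qed
  have D: "((\<lambda>x. f (a + L x)) has_derivative (\<lambda>v. frechet_derivative f (at (a + L x)) (L v))) (at x)"
    if "a + L x \<in> S" for x
  proof -
    have "((\<lambda>x. a + L x) has_derivative L) (at x)"
      using bounded_linear_imp_has_derivative[OF assms(2)] by (auto intro!: derivative_eq_intros)
    moreover have "(f has_derivative frechet_derivative f (at (a + L x))) (at (a + L x))"
      using that Suc.prems by (simp add: frechet_derivative_works[symmetric])
    ultimately show ?thesis
      using diff_chain_at[of "\<lambda>x. a + L x" L x f] by (simp add: o_def)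
  qed
  have "Ck_on k {x. a + L x \<in> S} (\<lambda>x. frechet_derivative f (at (a + L x)) (L v))" for v
    using Suc.IH[of "\<lambda>x. frechet_derivative f (at x) (L v)"] Suc.prems by simp
  then have "Ck_on k {x. a + L x \<in> S} (\<lambda>x. frechet_derivative (\<lambda>x. f (a + L x)) (at x) v)" for v
    by (subst Ck_on_cong[OF op]) (auto simp: frechet_derivativeI[OF D])
  then show ?case using D by (auto simp: differentiable_def)
qed

lemma smooth_on_cong: "open S \<Longrightarrow> (\<And>x. x \<in> S \<Longrightarrow> f x = g x) \<Longrightarrow> smooth_on S f \<longleftrightarrow> smooth_on S g"
  unfolding smooth_on_def using Ck_on_cong by blast

lemma smooth_on_const: "smooth_on S (\<lambda>x. a)"
  by (simp add: smooth_on_def Ck_on_const)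

lemma smooth_on_derivative: "smooth_on S f \<Longrightarrow> smooth_on S (\<lambda>x. frechet_derivative f (at x) v)"
  unfolding smooth_on_def by (metis Ck_on.simps(2))

lemma smooth_on_differentiable: "smooth_on S f \<Longrightarrow> x \<in> S \<Longrightarrow> f differentiable at x"
  unfolding smooth_on_def by (metis Ck_on.simps(2))

lemma smooth_on_slices:
  assumes "open S" "smooth_on S f"
  shows "smooth_on {x. (x, y) \<in> S} (\<lambda>x. f (x, y))" "smooth_on {y. (x, y) \<in> S} (\<lambda>y. f (x, y))"
proof -
  have "bounded_linear (\<lambda>x. (x, 0))" "bounded_linear (\<lambda>y. (0, y))"
    by (auto intro!: bounded_linear_Pair bounded_linear_zero bounded_linear_ident)
  then show "smooth_on {x. (x, y) \<in> S} (\<lambda>x. f (x, y))" "smooth_on {y. (x, y) \<in> S} (\<lambda>y. f (x, y))"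
    using Ck_on_affine[OF assms(1), of "\<lambda>x. (x, 0)" _ f "(0, y)"] Ck_on_affine[OF assms(1), of "\<lambda>y. (0, y)" _ f "(x, 0)"]
      assms(2)
    by (auto simp: smooth_on_def)
qed

text \<open>The mean value theorem, applied in direction \<open>v\<close> and then in direction
  \<open>w\<close>. It needs real values, hence the inner product with a fixed
  \<open>b\<close>.\<close>

lemma second_difference:
  fixes f :: "'a::real_normed_vector \<Rightarrow> 'b::real_inner"
  assumes f: "\<And>y. y \<in> S \<Longrightarrow> f differentiable at y"
    and f': "\<And>y. y \<in> S \<Longrightarrow> (\<lambda>y. frechet_derivative f (at y) v) differentiable at y"
    and t: "t > 0" and box: "\<And>s r. 0 \<le> s \<Longrightarrow> s \<le> t \<Longrightarrow> 0 \<le> r \<Longrightarrow> r \<le> t \<Longrightarrow> x + s *\<^sub>R v + r *\<^sub>R w \<in> S"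
  shows "\<exists>s r. 0 < s \<and> s < t \<and> 0 < r \<and> r < t \<and>
    (f (x + t *\<^sub>R v + t *\<^sub>R w) - f (x + t *\<^sub>R v) - f (x + t *\<^sub>R w) + f x) \<bullet> b
    = t * (t * (frechet_derivative (\<lambda>y. frechet_derivative f (at y) v) (at (x + s *\<^sub>R v + r *\<^sub>R w)) w \<bullet> b))"
proof -
  have D1: "((\<lambda>s. g (p + s *\<^sub>R q) \<bullet> b) has_real_derivative frechet_derivative g (at (p + s *\<^sub>R q)) q \<bullet> b) (at s)"
    if "g differentiable at (p + s *\<^sub>R q)" for g :: "'a \<Rightarrow> 'b" and p q s
  proof -
    have "((\<lambda>s. p + s *\<^sub>R q) has_derivative (\<lambda>s. s *\<^sub>R q)) (at s)"
      by (auto intro!: derivative_eq_intros)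
    from diff_chain_at[OF this] that
    have "(g \<circ> (\<lambda>s. p + s *\<^sub>R q) has_derivative frechet_derivative g (at (p + s *\<^sub>R q)) \<circ> (\<lambda>s. s *\<^sub>R q)) (at s)"
      by (simp add: frechet_derivative_works)
    from has_derivative_inner_left[OF this, of b]
    have "((\<lambda>s. g (p + s *\<^sub>R q) \<bullet> b) has_derivative (\<lambda>r. frechet_derivative g (at (p + s *\<^sub>R q)) (r *\<^sub>R q) \<bullet> b)) (at s)"
      by (simp add: o_def)
    moreover have "(\<lambda>r. frechet_derivative g (at (p + s *\<^sub>R q)) (r *\<^sub>R q) \<bullet> b) = (*) (frechet_derivative g (at (p + s *\<^sub>R q)) q \<bullet> b)"
      using linear_scale[OF linear_frechet_derivative[OF that]] by (simp add: fun_eq_iff mult.commute)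
    ultimately show ?thesis by (simp add: has_field_derivative_def)
  qed
  have box0: "x + s *\<^sub>R v \<in> S" if "0 \<le> s" "s \<le> t" for s using box[of s 0] that t by simp
  have perm: "x + s *\<^sub>R v + t *\<^sub>R w = (x + t *\<^sub>R w) + s *\<^sub>R v" for s by simp
  \<comment> \<open>The mean value theorem for the increment \<open>f (x + s *\<^sub>R v + t
    *\<^sub>R w) - f (x + s *\<^sub>R v)\<close> as a function of \<open>s\<close>.\<close>
  have "\<exists>s. 0 < s \<and> s < t \<and>
     (f (x + t *\<^sub>R v + t *\<^sub>R w) \<bullet> b - f (x + t *\<^sub>R v) \<bullet> b) - (f (x + 0 *\<^sub>R v + t *\<^sub>R w) \<bullet> b - f (x + 0 *\<^sub>R v) \<bullet> b)
     = (t - 0) * (frechet_derivative f (at (x + s *\<^sub>R v + t *\<^sub>R w)) v \<bullet> b - frechet_derivative f (at (x + s *\<^sub>R v)) v \<bullet> b)"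
    using t box[of _ t] unfolding perm
    by (intro MVT2 DERIV_diff D1 f box0) (auto simp: perm)
  then obtain s where s: "0 < s" "s < t" and e1: 
     "(f (x + t *\<^sub>R v + t *\<^sub>R w) - f (x + t *\<^sub>R v) - f (x + t *\<^sub>R w) + f x) \<bullet> b
     = t * (frechet_derivative f (at (x + s *\<^sub>R v + t *\<^sub>R w)) v \<bullet> b - frechet_derivative f (at (x + s *\<^sub>R v)) v \<bullet> b)"
    by (auto simp: inner_diff_left inner_add_left)
  have "\<exists>r. 0 < r \<and> r < t \<and>
     frechet_derivative f (at (x + s *\<^sub>R v + t *\<^sub>R w)) v \<bullet> b - frechet_derivative f (at (x + s *\<^sub>R v + 0 *\<^sub>R w)) v \<bullet> b
     = (t - 0) * (frechet_derivative (\<lambda>y. frechet_derivative f (at y) v) (at (x + s *\<^sub>R v + r *\<^sub>R w)) w \<bullet> b)"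
    using s by (intro MVT2 t D1 f' box) auto
  then obtain r where r: "0 < r" "r < t" and e2: 
     "frechet_derivative f (at (x + s *\<^sub>R v + t *\<^sub>R w)) v \<bullet> b - frechet_derivative f (at (x + s *\<^sub>R v)) v \<bullet> b
     = t * (frechet_derivative (\<lambda>y. frechet_derivative f (at y) v) (at (x + s *\<^sub>R v + r *\<^sub>R w)) w \<bullet> b)"
    by auto
  show ?thesis using s r e1 e2 by metis
qed

text \<open>The second difference over a parallelogram is symmetric in \<open>v\<close> and
  \<open>w\<close>, and it is \<open>t * t\<close> times either mixed derivative at some nearby
  point. Continuity of the mixed derivatives carries the equality to \<open>x\<close>.\<close>

lemma symmetric_second_derivative:
  fixes f :: "'a::real_normed_vector \<Rightarrow> 'b::real_inner"
  assumes S: "open S" "x \<in> S" and f: "Ck_on 2 S f"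
  shows "frechet_derivative (\<lambda>y. frechet_derivative f (at y) v) (at x) w
    = frechet_derivative (\<lambda>y. frechet_derivative f (at y) w) (at x) v" (is "?A = ?B")
proof (rule ccontr)
  define H where "H v w y = frechet_derivative (\<lambda>y. frechet_derivative f (at y) v) (at y) w" for v w y
  have d: "\<And>y. y \<in> S \<Longrightarrow> f differentiable at y"
    and d': "\<And>y v. y \<in> S \<Longrightarrow> (\<lambda>y. frechet_derivative f (at y) v) differentiable at y"
    and cont: "\<And>v w. continuous_on S (H v w)"
    using f by (simp_all add: numeral_2_eq_2 H_def)
  assume "?A \<noteq> ?B"
  then have ne: "H v w x \<noteq> H w v x" by (simp add: H_def)
  \<comment> \<open>Testing against the supposed gap itself makes its component along
    \<open>b\<close> equal to \<open>2 * e\<close>, while errors below \<open>e\<close> on both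
    sides would force it to be smaller.\<close>
  define b where "b = H v w x - H w v x"
  define e where "e = (b \<bullet> b) / 2"
  have "e > 0" using ne by (simp add: e_def b_def)
  have near: "\<forall>\<^sub>F y in at x. \<bar>H p q y \<bullet> b - H p q x \<bullet> b\<bar> < e" for p q
  proof -
    have "isCont (\<lambda>y. H p q y \<bullet> b) x"
      using cont[of p q] S by (auto simp: continuous_on_eq_continuous_at intro!: continuous_intros)
    then show ?thesis
      using \<open>e > 0\<close> by (auto simp: isCont_def tendsto_iff dist_real_def)
  qed
  have "\<forall>\<^sub>F y in at x. y \<in> S" using S by (auto intro: eventually_at_in_open')
  with near[of v w] near[of w v]
  have "\<forall>\<^sub>F y in at x. y \<in> S \<and> \<bar>H v w y \<bullet> b - H v w x \<bullet> b\<bar> < e \<and> \<bar>H w v y \<bullet> b - H w v x \<bullet> b\<bar> < e"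
    by eventually_elim auto
  then obtain d where d0: "d > 0" and dd: "\<And>y. dist y x < d \<Longrightarrow> y \<in> S \<and> \<bar>H v w y \<bullet> b - H v w x \<bullet> b\<bar> < e \<and> \<bar>H w v y \<bullet> b - H w v x \<bullet> b\<bar> < e"
    using \<open>e > 0\<close> S unfolding eventually_at by (metis UNIV_I abs_zero diff_self)
  \<comment> \<open>With this \<open>N\<close> the whole parallelogram of side parameter
    \<open>t\<close> stays within \<open>d / 2\<close> of \<open>x\<close>; the summand 1 keeps
    \<open>N\<close> positive when \<open>v\<close> and \<open>w\<close> vanish.\<close>
  define N where "N = 1 + norm v + norm w"
  define t where "t = d / (2 * N)"
  have pos: "N > 0" by (simp add: N_def add_pos_nonneg)
  then have t: "t > 0" using d0 by (simp add: t_def)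
  have box: "dist (x + s *\<^sub>R v + r *\<^sub>R w) x < d" "dist (x + r *\<^sub>R w + s *\<^sub>R v) x < d"
    if "0 \<le> s" "s \<le> t" "0 \<le> r" "r \<le> t" for s r
  proof -
    have "norm (s *\<^sub>R v + r *\<^sub>R w) \<le> s * norm v + r * norm w"
      using that norm_triangle_ineq[of "s *\<^sub>R v" "r *\<^sub>R w"] by simp
    also have "\<dots> \<le> t * norm v + t * norm w"
      using that by (intro add_mono mult_right_mono) auto
    also have "\<dots> \<le> t * N" using t by (simp add: N_def algebra_simps)
    also have "\<dots> = d / 2" using pos by (simp add: t_def)
    also have "\<dots> < d" using d0 by simp
    finally show "dist (x + s *\<^sub>R v + r *\<^sub>R w) x < d" "dist (x + r *\<^sub>R w + s *\<^sub>R v) x < d"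
      by (simp_all add: dist_norm add.assoc add.commute[of "r *\<^sub>R w"])
  qed
  obtain s r where sr: "0 < s" "s < t" "0 < r" "r < t" and e1: "(f (x + t *\<^sub>R v + t *\<^sub>R w) - f (x + t *\<^sub>R v) - f (x + t *\<^sub>R w) + f x) \<bullet> b
    = t * (t * (H v w (x + s *\<^sub>R v + r *\<^sub>R w) \<bullet> b))"
    using second_difference[of S f v t x w b, folded H_def, OF d d' t] box(1) dd by blast
  obtain s' r' where sr': "0 < s'" "s' < t" "0 < r'" "r' < t" and e2: "(f (x + t *\<^sub>R w + t *\<^sub>R v) - f (x + t *\<^sub>R w) - f (x + t *\<^sub>R v) + f x) \<bullet> b
    = t * (t * (H w v (x + s' *\<^sub>R w + r' *\<^sub>R v) \<bullet> b))"
    using second_difference[of S f w t x v b, folded H_def, OF d d' t] box(2) dd by blast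
  have "x + t *\<^sub>R w + t *\<^sub>R v = x + t *\<^sub>R v + t *\<^sub>R w" by simp
  then have "t * (t * (H v w (x + s *\<^sub>R v + r *\<^sub>R w) \<bullet> b)) = t * (t * (H w v (x + s' *\<^sub>R w + r' *\<^sub>R v) \<bullet> b))"
    unfolding e1[symmetric] e2[symmetric] by (simp add: algebra_simps)
  then have "H v w (x + s *\<^sub>R v + r *\<^sub>R w) \<bullet> b = H w v (x + s' *\<^sub>R w + r' *\<^sub>R v) \<bullet> b"
    using t by simp
  moreover have "\<bar>H v w (x + s *\<^sub>R v + r *\<^sub>R w) \<bullet> b - H v w x \<bullet> b\<bar> < e"
    using dd[OF box(1)[of s r]] sr by simp
  moreover have "\<bar>H w v (x + s' *\<^sub>R w + r' *\<^sub>R v) \<bullet> b - H w v x \<bullet> b\<bar> < e"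
    using dd[OF box(2)[of r' s']] sr' by simp
  ultimately have "\<bar>H v w x \<bullet> b - H w v x \<bullet> b\<bar> < 2 * e" by linarith
  then show False by (simp add: e_def b_def inner_diff_left[symmetric])
qed

text \<open>Related fields have related brackets. Differentiating
  \<open>Z' (\<phi> y) = D\<phi>(y) (Z y)\<close> along the other field produces one term with the
  second derivative of \<phi>; it is symmetric in the two fields and cancels in the bracket.\<close>

lemma bracket_natural:
  fixes \<phi> :: "'a::euclidean_space \<Rightarrow> 'b::real_inner"
  assumes S: "open S" "x \<in> S" and \<phi>: "Ck_on 2 S \<phi>"
    and X: "X differentiable at x" and Y: "Y differentiable at x"
    and X': "X' differentiable at (\<phi> x)" and Y': "Y' differentiable at (\<phi> x)"
    and relX: "\<And>y. y \<in> S \<Longrightarrow> X' (\<phi> y) = frechet_derivative \<phi> (at y) (X y)"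
    and relY: "\<And>y. y \<in> S \<Longrightarrow> Y' (\<phi> y) = frechet_derivative \<phi> (at y) (Y y)"
  shows "frechet_derivative Y' (at (\<phi> x)) (X' (\<phi> x)) - frechet_derivative X' (at (\<phi> x)) (Y' (\<phi> x))
    = frechet_derivative \<phi> (at x) (frechet_derivative Y (at x) (X x) - frechet_derivative X (at x) (Y x))"
proof -
  have d: "\<And>y. y \<in> S \<Longrightarrow> \<phi> differentiable at y"
    and d': "\<And>y v. y \<in> S \<Longrightarrow> (\<lambda>y. frechet_derivative \<phi> (at y) v) differentiable at y"
    using \<phi> by (simp_all add: numeral_2_eq_2)
  let ?H = "\<lambda>v. frechet_derivative (\<lambda>y. frechet_derivative \<phi> (at y) v) (at x)"
  have linH: "linear (?H v)" for v using d' S by (intro linear_frechet_derivative)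
  have lin\<phi>: "linear (frechet_derivative \<phi> (at y))" if "y \<in> S" for y
    using d that by (intro linear_frechet_derivative)
  have key: "frechet_derivative Z' (at (\<phi> x)) (frechet_derivative \<phi> (at x) \<xi>)
      = frechet_derivative \<phi> (at x) (frechet_derivative Z (at x) \<xi>) + ?H \<xi> (Z x)"
    if Z: "Z differentiable at x" and Z': "Z' differentiable at (\<phi> x)"
      and rel: "\<And>y. y \<in> S \<Longrightarrow> Z' (\<phi> y) = frechet_derivative \<phi> (at y) (Z y)" for Z Z' \<xi>
  proof -
    have "(Z' \<circ> \<phi> has_derivative frechet_derivative Z' (at (\<phi> x)) \<circ> frechet_derivative \<phi> (at x)) (at x)"
      using d[OF S(2)] Z' by (intro diff_chain_at) (simp_all add: frechet_derivative_works)
    then have 1: "frechet_derivative (Z' \<circ> \<phi>) (at x) = frechet_derivative Z' (at (\<phi> x)) \<circ> frechet_derivative \<phi> (at x)"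
      by (rule frechet_derivativeI)
    \<comment> \<open>Differentiability of the derivative of \<phi> is known only for fixed
      directions, so \<open>Z y\<close> is expanded in the standard basis before the product rule is
      used.\<close>
    have exp: "(Z' \<circ> \<phi>) y = (\<Sum>b\<in>Basis. (Z y \<bullet> b) *\<^sub>R frechet_derivative \<phi> (at y) b)" if "y \<in> S" for y
    proof -
      have "frechet_derivative \<phi> (at y) (Z y) = frechet_derivative \<phi> (at y) (\<Sum>b\<in>Basis. (Z y \<bullet> b) *\<^sub>R b)"
        by (simp add: euclidean_representation)
      then show ?thesis
        by (simp add: rel[OF that] linear_sum[OF lin\<phi>[OF that]] linear_scale[OF lin\<phi>[OF that]] del: euclidean_representation)
    qed
    have "((\<lambda>y. \<Sum>b\<in>Basis. (Z y \<bullet> b) *\<^sub>R frechet_derivative \<phi> (at y) b) has_derivative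
       (\<lambda>\<xi>. \<Sum>b\<in>Basis. (Z x \<bullet> b) *\<^sub>R ?H b \<xi> + (frechet_derivative Z (at x) \<xi> \<bullet> b) *\<^sub>R frechet_derivative \<phi> (at x) b)) (at x)"
      using Z d'[OF S(2)]
      by (intro has_derivative_sum has_derivative_scaleR has_derivative_inner_left)
         (simp_all add: frechet_derivative_works)
    then have "frechet_derivative (Z' \<circ> \<phi>) (at x) \<xi>
       = (\<Sum>b\<in>Basis. (Z x \<bullet> b) *\<^sub>R ?H b \<xi> + (frechet_derivative Z (at x) \<xi> \<bullet> b) *\<^sub>R frechet_derivative \<phi> (at x) b)"
      by (subst frechet_derivative_cong_open[OF S exp]) (simp_all add: frechet_derivativeI)
    also have "\<dots> = (\<Sum>b\<in>Basis. (Z x \<bullet> b) *\<^sub>R ?H \<xi> b) + (\<Sum>b\<in>Basis. (frechet_derivative Z (at x) \<xi> \<bullet> b) *\<^sub>R frechet_derivative \<phi> (at x) b)"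
      by (simp add: sum.distrib symmetric_second_derivative[OF S \<phi>, of _ \<xi>])
    also have "(\<Sum>b\<in>Basis. (Z x \<bullet> b) *\<^sub>R ?H \<xi> b) = ?H \<xi> (\<Sum>b\<in>Basis. (Z x \<bullet> b) *\<^sub>R b)"
      by (simp add: linear_sum[OF linH] linear_scale[OF linH] del: euclidean_representation)
    also have "(\<Sum>b\<in>Basis. (frechet_derivative Z (at x) \<xi> \<bullet> b) *\<^sub>R frechet_derivative \<phi> (at x) b)
      = frechet_derivative \<phi> (at x) (\<Sum>b\<in>Basis. (frechet_derivative Z (at x) \<xi> \<bullet> b) *\<^sub>R b)"
      by (simp add: linear_sum[OF lin\<phi>[OF S(2)]] linear_scale[OF lin\<phi>[OF S(2)]] del: euclidean_representation)
    finally show ?thesis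
      using fun_cong[OF 1, of \<xi>] by (simp add: o_def euclidean_representation add.commute)
  qed
  have "frechet_derivative X' (at (\<phi> x)) (frechet_derivative \<phi> (at x) \<xi>)
      = frechet_derivative \<phi> (at x) (frechet_derivative X (at x) \<xi>) + ?H \<xi> (X x)"
    "frechet_derivative Y' (at (\<phi> x)) (frechet_derivative \<phi> (at x) \<xi>)
      = frechet_derivative \<phi> (at x) (frechet_derivative Y (at x) \<xi>) + ?H \<xi> (Y x)" for \<xi>
    by (rule key[OF X X' relX] key[OF Y Y' relY]; assumption)+
  then show ?thesis
    unfolding relX[OF S(2)] relY[OF S(2)] linear_diff[OF lin\<phi>[OF S(2)]]
    by (simp add: symmetric_second_derivative[OF S \<phi>, of "Y x" "X x"])
qed

section \<open>Orthonormal bases\<close>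

locale inner_product_form =
  fixes G :: "real^'n::finite \<Rightarrow> real^'n \<Rightarrow> real"
  assumes bilinear_G: "bilinear G"
    and sym_G: "G v w = G w v"
    and pos_G: "v \<noteq> 0 \<Longrightarrow> G v v > 0"
begin

lemma linear_G_left: "linear (\<lambda>v. G v w)" and linear_G_right: "linear (G v)"
  using bilinear_G by (simp_all add: bilinear_def)

definition orthonormal :: "(real^'n) set \<Rightarrow> bool" where
  "orthonormal B \<longleftrightarrow> finite B \<and> (\<forall>x\<in>B. \<forall>y\<in>B. G x y = (if x = y then 1 else 0))"

lemma G_sum_orthonormal:
  assumes "orthonormal B" "y \<in> B"
  shows "G (\<Sum>x\<in>B. f x *\<^sub>R x) y = f y"
proof -
  have "G (\<Sum>x\<in>B. f x *\<^sub>R x) y = (\<Sum>x\<in>B. f x * G x y)"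
    by (simp add: linear_sum[OF linear_G_left] linear_scale[OF linear_G_left])
  also have "\<dots> = (\<Sum>x\<in>B. if x = y then f x else 0)"
    using assms by (intro sum.cong) (auto simp: orthonormal_def)
  finally show ?thesis using assms by (simp add: orthonormal_def)
qed

lemma orthonormal_independent:
  assumes "orthonormal B"
  shows "independent B"
proof -
  have "f y = 0" if "(\<Sum>x\<in>B. f x *\<^sub>R x) = 0" "y \<in> B" for f y
    using G_sum_orthonormal[OF assms that(2), of f] that(1) linear_0[OF linear_G_left] by simp
  then show ?thesis
    using assms by (auto simp: independent_explicit orthonormal_def)
qed

text \<open>Gram-Schmidt for \<open>G\<close> inside \<open>V\<close>, starting from a given set. It
  stops because orthonormal sets are independent, so their size is at most
  \<open>dim V\<close>.\<close>

lemma orthonormal_extend: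
  assumes "subspace V" "orthonormal B" "B \<subseteq> V"
  shows "\<exists>B'. B \<subseteq> B' \<and> orthonormal B' \<and> B' \<subseteq> V \<and> span B' = V"
  using assms(2,3)
proof (induction "dim V - card B" arbitrary: B rule: less_induct)
  case less
  show ?case
  proof (cases "span B = V")
    case True
    then show ?thesis using less.prems by blast
  next
    case False
    have "span B \<subseteq> V" using less.prems assms(1) by (simp add: span_minimal)
    with False obtain v where v: "v \<in> V" "v \<notin> span B" by blast
    define w where "w = v - (\<Sum>x\<in>B. G v x *\<^sub>R x)"
    have sumB: "(\<Sum>x\<in>B. G v x *\<^sub>R x) \<in> span B"
      by (intro span_sum span_scale span_base)
    then have wV: "w \<in> V"
      unfolding w_def using v \<open>span B \<subseteq> V\<close> assms(1) by (blast intro: subspace_diff)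
    have "w \<noteq> 0" using v(2) sumB by (auto simp: w_def)
    then have Gw: "G w w > 0" by (rule pos_G)
    have orth: "G w y = 0" if "y \<in> B" for y
      unfolding w_def linear_diff[OF linear_G_left] G_sum_orthonormal[OF less.prems(1) that] by simp
    define z where "z = (1 / sqrt (G w w)) *\<^sub>R w"
    have zz: "G z z = 1"
      using Gw by (simp add: z_def linear_scale[OF linear_G_left] linear_scale[OF linear_G_right]
          real_sqrt_mult[symmetric] field_simps power2_eq_square[symmetric])
    have zy: "G z y = 0" "G y z = 0" if "y \<in> B" for y
      using orth[OF that] sym_G[of y z] by (simp_all add: z_def linear_scale[OF linear_G_left])
    have "z \<notin> B" using zz zy by force
    have on: "orthonormal (insert z B)"
      using less.prems(1) zz zy by (auto simp: orthonormal_def)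
    have sub: "insert z B \<subseteq> V"
      using less.prems(2) wV assms(1) by (simp add: z_def subspace_scale)
    have "card (insert z B) \<le> dim V"
      using independent_card_le_dim[OF sub orthonormal_independent[OF on]] .
    moreover have "card (insert z B) = Suc (card B)"
      using \<open>z \<notin> B\<close> less.prems(1) by (simp add: orthonormal_def)
    ultimately have "dim V - card (insert z B) < dim V - card B" by linarith
    from less.hyps[OF this on sub] show ?thesis by blast
  qed
qed

lemma orthonormal_family:
  fixes b :: "'n \<Rightarrow> real^'n"
  assumes "\<And>i j. G (b i) (b j) = (if i = j then 1 else 0)"
  shows "inj b" "independent (range b)" "v = (\<Sum>k\<in>UNIV. G v (b k) *\<^sub>R b k)"
proof -
  show inj: "inj b"
    by (rule injI) (metis assms zero_neq_one)
  have on: "orthonormal (range b)"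
    using inj assms by (auto simp: orthonormal_def inj_eq)
  show ind: "independent (range b)"
    by (rule orthonormal_independent[OF on])
  have "card (range b) = CARD('n)" using inj by (simp add: card_image)
  then have span: "span (range b) = UNIV"
    using ind card_ge_dim_independent[of "range b" UNIV] by auto
  define w where "w = v - (\<Sum>k\<in>UNIV. G v (b k) *\<^sub>R b k)"
  have "(\<Sum>k\<in>UNIV. G v (b k) *\<^sub>R b k) = (\<Sum>x\<in>range b. G v x *\<^sub>R x)"
    using inj by (simp add: sum.reindex)
  then have "G w (b k) = 0" for k
    using G_sum_orthonormal[OF on, of "b k" "G v"] by (simp add: w_def linear_diff[OF linear_G_left])
  then have "G w x = 0" if "x \<in> span (range b)" for x
    using linear_eq_0_on_span[OF linear_G_right _ that, of w] by auto
  then have "G w w = 0" by (simp add: span)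
  then have "w = 0" using pos_G[of w] by fastforce
  then show "v = (\<Sum>k\<in>UNIV. G v (b k) *\<^sub>R b k)" by (simp add: w_def)
qed

text \<open>An orthonormal basis of \<open>Z\<close> is extended to the whole space and indexed by
  \<open>'n\<close>; \<open>S\<close> marks the vectors that came from \<open>Z\<close>.\<close>

lemma adapted_orthonormal_basis:
  assumes "subspace Z"
  shows "\<exists>(b :: 'n \<Rightarrow> real^'n) S. (\<forall>i j. G (b i) (b j) = (if i = j then 1 else 0)) \<and>
    (\<forall>i\<in>S. b i \<in> Z) \<and> (\<forall>z\<in>Z. \<forall>k. k \<notin> S \<longrightarrow> G z (b k) = 0)"
proof -
  obtain B1 where B1: "orthonormal B1" "B1 \<subseteq> Z" "span B1 = Z"
    using orthonormal_extend[OF assms, of "{}"] by (auto simp: orthonormal_def)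
  obtain B2 where B2: "B1 \<subseteq> B2" "orthonormal B2" "span B2 = UNIV"
    using orthonormal_extend[OF subspace_UNIV B1(1)] by auto
  have "card B2 = CARD('n)"
    using orthonormal_independent[OF B2(2)] B2(3)
    by (metis dim_span_eq_card_independent dim_UNIV DIM_cart DIM_real mult.right_neutral)
  then obtain b :: "'n \<Rightarrow> real^'n" where b: "bij_betw b UNIV B2"
    using B2(2) finite_same_card_bij[of "UNIV :: 'n set" B2] by (auto simp: orthonormal_def)
  have "G (b i) (b j) = (if i = j then 1 else 0)" for i j
    using B2(2) b by (auto simp: orthonormal_def bij_betw_def inj_eq)
  moreover have "b i \<in> Z" if "i \<in> {i. b i \<in> B1}" for i using that B1(2) by auto
  moreover have "G z (b k) = 0" if z: "z \<in> Z" and k: "k \<notin> {i. b i \<in> B1}" for z k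
  proof -
    have "b k \<in> B2" using b by (auto simp: bij_betw_def)
    then have "G x (b k) = 0" if "x \<in> B1" for x
      using B2 that k by (auto simp: orthonormal_def)
    then show ?thesis
      using linear_eq_0_on_span[OF linear_G_left _ z[folded B1(3)]] by auto
  qed
  ultimately show ?thesis by (intro exI[of _ b] exI[of _ "{i. b i \<in> B1}"]) blast
qed

end

section \<open>Naturality of the Lie bracket\<close>

locale smooth_manifold =
  fixes A :: "('a::{t2_space,second_countable_topology}, 'n::finite) chart set"
  assumes atlas: "smooth_atlas A"
begin

lemma chart_at: "chart_at A p \<in> A" "p \<in> fst (chart_at A p)"
proof -
  have "\<exists>c. c \<in> A \<and> p \<in> fst c" using atlas unfolding smooth_atlas_def by blast
  then have "chart_at A p \<in> A \<and> p \<in> fst (chart_at A p)"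
    unfolding chart_at_def by (rule someI_ex)
  then show "chart_at A p \<in> A" "p \<in> fst (chart_at A p)" by auto
qed

lemma
  assumes "c \<in> A"
  shows open_chart_domain: "open (fst c)"
    and open_chart_image: "open (chart_image c)"
    and homeomorphism_chart: "homeomorphism (fst c) (chart_image c) (snd c) (chart_inv c)"
  using atlas assms unfolding smooth_atlas_def by blast+

lemma chart_inv_chart: "c \<in> A \<Longrightarrow> p \<in> fst c \<Longrightarrow> chart_inv c (snd c p) = p"
  and chart_chart_inv: "c \<in> A \<Longrightarrow> x \<in> chart_image c \<Longrightarrow> snd c (chart_inv c x) = x"
  and chart_inv_in: "c \<in> A \<Longrightarrow> x \<in> chart_image c \<Longrightarrow> chart_inv c x \<in> fst c"
  and continuous_chart_inv: "c \<in> A \<Longrightarrow> continuous_on (chart_image c) (chart_inv c)"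
  using homeomorphism_chart[of c] unfolding homeomorphism_def by auto

lemma chart_in_image: "p \<in> fst c \<Longrightarrow> snd c p \<in> chart_image c"
  by (simp add: chart_image_def)

definition chart_preimage :: "('a, 'n) chart \<Rightarrow> 'a set \<Rightarrow> (real^'n) set" where
  "chart_preimage c U = {x \<in> chart_image c. chart_inv c x \<in> U}"

lemma open_chart_preimage:
  assumes "c \<in> A" "open U"
  shows "open (chart_preimage c U)"
proof -
  have "chart_preimage c U = chart_image c \<inter> chart_inv c -` U"
    by (auto simp: chart_preimage_def)
  then show ?thesis
    using continuous_open_preimage[OF continuous_chart_inv open_chart_image] assms by simp
qed

lemma chart_in_preimage: "c \<in> A \<Longrightarrow> p \<in> fst c \<Longrightarrow> p \<in> U \<Longrightarrow> snd c p \<in> chart_preimage c U"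
  by (simp add: chart_preimage_def chart_in_image chart_inv_chart)

lemma smooth_transition:
  assumes "c \<in> A" "d \<in> A"
  shows "smooth_on (chart_preimage c (fst d)) (snd d \<circ> chart_inv c)"
proof -
  have "snd c ` (fst c \<inter> fst d) = chart_preimage c (fst d)"
  proof (intro set_eqI iffI)
    fix x assume "x \<in> chart_preimage c (fst d)"
    then have "x = snd c (chart_inv c x)" "chart_inv c x \<in> fst c \<inter> fst d"
      using assms(1) by (simp_all add: chart_preimage_def chart_chart_inv chart_inv_in)
    then show "x \<in> snd c ` (fst c \<inter> fst d)" by (rule image_eqI)
  qed (auto simp: assms chart_in_preimage)
  moreover have "smooth_on (snd c ` (fst c \<inter> fst d)) (snd d \<circ> chart_inv c)"
    using atlas assms unfolding smooth_atlas_def by blast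
  ultimately show ?thesis by simp
qed

text \<open>The differential in freely chosen charts. \<open>differential\<close> is the case of the
  two reference charts and \<open>field_in_chart\<close> uses the case of the identity map, so one
  chain rule covers both.\<close>

definition chart_deriv :: "('a \<Rightarrow> 'a) \<Rightarrow> ('a, 'n) chart \<Rightarrow> ('a, 'n) chart \<Rightarrow> 'a \<Rightarrow> real^'n \<Rightarrow> real^'n" where
  "chart_deriv f c d p = frechet_derivative (snd d \<circ> f \<circ> chart_inv c) (at (snd c p))"

definition smooth_map :: "('a \<Rightarrow> 'a) \<Rightarrow> bool" where
  "smooth_map f \<longleftrightarrow> continuous_on UNIV f \<and>
     (\<forall>c\<in>A. \<forall>d\<in>A. smooth_on (chart_preimage c (f -` fst d)) (snd d \<circ> f \<circ> chart_inv c))"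

lemma smooth_mapD:
  assumes "smooth_map f" "c \<in> A" "d \<in> A"
  shows "open (chart_preimage c (f -` fst d))"
    and "smooth_on (chart_preimage c (f -` fst d)) (snd d \<circ> f \<circ> chart_inv c)"
    and "p \<in> fst c \<Longrightarrow> f p \<in> fst d \<Longrightarrow> (snd d \<circ> f \<circ> chart_inv c) differentiable at (snd c p)"
proof -
  show "open (chart_preimage c (f -` fst d))"
    using assms open_chart_domain by (intro open_chart_preimage open_vimage) (auto simp: smooth_map_def)
  show s: "smooth_on (chart_preimage c (f -` fst d)) (snd d \<circ> f \<circ> chart_inv c)"
    using assms by (simp add: smooth_map_def)
  show "(snd d \<circ> f \<circ> chart_inv c) differentiable at (snd c p)" if "p \<in> fst c" "f p \<in> fst d"
    using s by (rule smooth_on_differentiable) (simp add: that assms chart_in_preimage)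
qed

lemma smooth_map_id: "smooth_map (\<lambda>p. p)"
proof -
  have "(\<lambda>p. p) -` U = U" for U :: "'a set" by auto
  moreover have "snd d \<circ> (\<lambda>p. p) \<circ> chart_inv c = snd d \<circ> chart_inv c" for c d :: "('a, 'n) chart"
    by (simp add: fun_eq_iff)
  ultimately show ?thesis
    by (simp add: smooth_map_def smooth_transition)
qed

lemma linear_chart_deriv:
  "smooth_map f \<Longrightarrow> c \<in> A \<Longrightarrow> d \<in> A \<Longrightarrow> p \<in> fst c \<Longrightarrow> f p \<in> fst d \<Longrightarrow> linear (chart_deriv f c d p)"
  unfolding chart_deriv_def by (rule linear_frechet_derivative[OF smooth_mapD(3)])

lemma chart_deriv_comp:
  assumes "smooth_map f" "smooth_map g" "c \<in> A" "d \<in> A" "e \<in> A"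
    and "p \<in> fst c" "g p \<in> fst d" "f (g p) \<in> fst e"
  shows "chart_deriv (\<lambda>q. f (g q)) c e p v = chart_deriv f d e (g p) (chart_deriv g c d p v)"
proof -
  let ?f = "snd e \<circ> f \<circ> chart_inv d" and ?g = "snd d \<circ> g \<circ> chart_inv c"
  have gp: "?g (snd c p) = snd d (g p)" using assms by (simp add: chart_inv_chart)
  have "frechet_derivative (snd e \<circ> (\<lambda>q. f (g q)) \<circ> chart_inv c) (at (snd c p))
      = frechet_derivative (?f \<circ> ?g) (at (snd c p))"
  proof (rule frechet_derivative_cong_open)
    show "open (chart_preimage c (g -` fst d))" using assms smooth_mapD(1) by blast
    show "snd c p \<in> chart_preimage c (g -` fst d)" using assms by (simp add: chart_in_preimage)
  qed (use assms in \<open>auto simp: chart_preimage_def chart_inv_chart\<close>)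
  also have "\<dots> = frechet_derivative ?f (at (?g (snd c p))) \<circ> frechet_derivative ?g (at (snd c p))"
  proof (rule frechet_derivative_compose)
    show "?g differentiable at (snd c p)" by (rule smooth_mapD(3)[OF assms(2,3,4,6,7)])
    show "?f differentiable at (?g (snd c p))" unfolding gp by (rule smooth_mapD(3)[OF assms(1,4,5,7,8)])
  qed
  finally show ?thesis unfolding gp chart_deriv_def by simp
qed

lemma chart_deriv_id: "c \<in> A \<Longrightarrow> p \<in> fst c \<Longrightarrow> chart_deriv (\<lambda>p. p) c c p v = v"
proof -
  assume "c \<in> A" "p \<in> fst c"
  then have "frechet_derivative (snd c \<circ> (\<lambda>p. p) \<circ> chart_inv c) (at (snd c p))
     = frechet_derivative (\<lambda>x. x) (at (snd c p))"
    by (intro frechet_derivative_cong_open[OF open_chart_image[of c]])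
       (simp_all add: chart_in_image chart_chart_inv)
  then show ?thesis by (simp add: chart_deriv_def)
qed

lemma differential_chart_deriv:
  "differential A f p = chart_deriv f (chart_at A p) (chart_at A (f p)) p"
  by (simp add: differential_def chart_deriv_def coords_at_def)

lemma field_in_chart_chart_deriv:
  "c \<in> A \<Longrightarrow> p \<in> fst c \<Longrightarrow> field_in_chart A c X (snd c p) = chart_deriv (\<lambda>p. p) (chart_at A p) c p (X p)"
  by (simp add: field_in_chart_def chart_inv_chart chart_deriv_def coords_at_def o_def)

lemma lie_bracket_natural:
  assumes f: "smooth_map f" and X: "smooth_field A X" and Y: "smooth_field A Y"
    and relX: "\<And>p. X (f p) = differential A f p (X p)"
    and relY: "\<And>p. Y (f p) = differential A f p (Y p)"
  shows "lie_bracket A X Y (f p) = differential A f p (lie_bracket A X Y p)"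
proof -
  define c where "c = chart_at A p"
  define d where "d = chart_at A (f p)"
  define S where "S = chart_preimage c (f -` fst d)"
  define \<phi> where "\<phi> = snd d \<circ> f \<circ> chart_inv c"
  have c: "c \<in> A" "p \<in> fst c" and d: "d \<in> A" "f p \<in> fst d"
    by (simp_all add: c_def d_def chart_at)
  have S: "open S" "snd c p \<in> S"
    using smooth_mapD(1)[OF f c(1) d(1)] c d by (simp_all add: S_def chart_in_preimage)
  have \<phi>p: "\<phi> (snd c p) = snd d (f p)" by (simp add: \<phi>_def c chart_inv_chart)
  \<comment> \<open>The hypothesis at a nearby point \<open>q\<close> is stated in the reference
    charts at \<open>q\<close> and \<open>f q\<close>. The chain rule transports it to the fixed
    charts \<open>c\<close> and \<open>d\<close>, where the fields can be differentiated.\<close>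
  have rel: "field_in_chart A d Z (\<phi> y) = frechet_derivative \<phi> (at y) (field_in_chart A c Z y)"
    if rel: "\<And>p. Z (f p) = differential A f p (Z p)" and y: "y \<in> S" for Z y
  proof -
    define q where "q = chart_inv c y"
    have q: "q \<in> fst c" "f q \<in> fst d" "y = snd c q"
      using y c by (auto simp: S_def chart_preimage_def q_def chart_inv_in chart_chart_inv)
    have "\<phi> y = snd d (f q)" by (simp add: \<phi>_def q_def)
    then have "field_in_chart A d Z (\<phi> y) = chart_deriv (\<lambda>p. p) (chart_at A (f q)) d (f q) (Z (f q))"
      using field_in_chart_chart_deriv[OF d(1) q(2)] by simp
    also have "\<dots> = chart_deriv f (chart_at A q) d q (Z q)"
      unfolding rel differential_chart_deriv
      using chart_deriv_comp[OF smooth_map_id f chart_at(1) chart_at(1) d(1) chart_at(2) chart_at(2) q(2)] by simp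
    also have "\<dots> = chart_deriv f c d q (chart_deriv (\<lambda>p. p) (chart_at A q) c q (Z q))"
      using chart_deriv_comp[OF f smooth_map_id chart_at(1) c(1) d(1) chart_at(2) q(1,2)] by simp
    also have "\<dots> = frechet_derivative \<phi> (at y) (field_in_chart A c Z y)"
      unfolding q(3) field_in_chart_chart_deriv[OF c(1) q(1)] by (simp add: chart_deriv_def \<phi>_def)
    finally show ?thesis .
  qed
  have diff: "field_in_chart A e Z differentiable at (snd e q)"
    if "smooth_field A Z" "e \<in> A" "q \<in> fst e" for e Z q
    using that by (intro smooth_on_differentiable[of "chart_image e"]) (auto simp: smooth_field_def chart_in_image)
  have val: "field_in_chart A (chart_at A q) Z (snd (chart_at A q) q) = Z q" for Z q
    by (simp add: field_in_chart_chart_deriv chart_at chart_deriv_id)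
  have "Ck_on 2 S \<phi>"
    using smooth_mapD(2)[OF f c(1) d(1)] by (simp add: S_def \<phi>_def smooth_on_def)
  from bracket_natural[OF S this, of "field_in_chart A c X" "field_in_chart A c Y" "field_in_chart A d X" "field_in_chart A d Y"]
  have "frechet_derivative (field_in_chart A d Y) (at (\<phi> (snd c p))) (field_in_chart A d X (\<phi> (snd c p)))
     - frechet_derivative (field_in_chart A d X) (at (\<phi> (snd c p))) (field_in_chart A d Y (\<phi> (snd c p)))
     = frechet_derivative \<phi> (at (snd c p))
        (frechet_derivative (field_in_chart A c Y) (at (snd c p)) (field_in_chart A c X (snd c p))
         - frechet_derivative (field_in_chart A c X) (at (snd c p)) (field_in_chart A c Y (snd c p)))"
    using rel[OF relX] rel[OF relY] diff[OF X] diff[OF Y] c d by (simp add: \<phi>p)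
  then show ?thesis
    unfolding \<phi>p unfolding c_def d_def val
    by (simp add: lie_bracket_def coords_at_def differential_def \<phi>_def c_def d_def)
qed

end

section \<open>Left-invariant vector fields\<close>

locale lie_group_manifold =
  fixes A :: "('a::{t2_space,second_countable_topology}, 'n::finite) chart set"
    and mul :: "'a \<Rightarrow> 'a \<Rightarrow> 'a" and u :: 'a and iv :: "'a \<Rightarrow> 'a"
  assumes lie_group: "lie_group A mul u iv"

sublocale lie_group_manifold \<subseteq> smooth_manifold A
  using lie_group by unfold_locales (simp add: lie_group_def)

sublocale lie_group_manifold \<subseteq> G: group mul u iv
  using lie_group by (simp add: lie_group_def)

context lie_group_manifold
begin

definition mul_dom :: "('a, 'n) chart \<Rightarrow> ('a, 'n) chart \<Rightarrow> ('a, 'n) chart \<Rightarrow> ((real^'n) \<times> (real^'n)) set" where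
  "mul_dom c d k = {(x, y). x \<in> chart_image c \<and> y \<in> chart_image d \<and> mul (chart_inv c x) (chart_inv d y) \<in> fst k}"

definition mul_chart :: "('a, 'n) chart \<Rightarrow> ('a, 'n) chart \<Rightarrow> ('a, 'n) chart \<Rightarrow> (real^'n) \<times> (real^'n) \<Rightarrow> real^'n" where
  "mul_chart c d k = (\<lambda>(x, y). snd k (mul (chart_inv c x) (chart_inv d y)))"

lemma smooth_mul_chart: "c \<in> A \<Longrightarrow> d \<in> A \<Longrightarrow> k \<in> A \<Longrightarrow> smooth_on (mul_dom c d k) (mul_chart c d k)"
  using lie_group by (simp add: lie_group_def mul_dom_def mul_chart_def)

lemma continuous_mul: "continuous_on UNIV (\<lambda>(p, q). mul p q)"
  using lie_group by (simp add: lie_group_def)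

lemma open_mul_dom:
  assumes "c \<in> A" "d \<in> A" "k \<in> A"
  shows "open (mul_dom c d k)"
proof -
  let ?S = "chart_image c \<times> chart_image d"
  have "continuous_on ?S (\<lambda>z. chart_inv c (fst z))" "continuous_on ?S (\<lambda>z. chart_inv d (snd z))"
    by (auto intro!: continuous_on_compose2[OF continuous_chart_inv] continuous_intros assms)
  then have "continuous_on ?S (\<lambda>z. (chart_inv c (fst z), chart_inv d (snd z)))"
    by (rule continuous_on_Pair)
  then have "continuous_on ?S (\<lambda>z. (\<lambda>(p, q). mul p q) (chart_inv c (fst z), chart_inv d (snd z)))"
    by (rule continuous_on_compose2[OF continuous_mul]) auto
  then have "open (?S \<inter> (\<lambda>z. mul (chart_inv c (fst z)) (chart_inv d (snd z))) -` fst k)"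
    using assms by (intro continuous_open_preimage) (auto intro!: open_Times open_chart_image open_chart_domain)
  also have "?S \<inter> (\<lambda>z. mul (chart_inv c (fst z)) (chart_inv d (snd z))) -` fst k = mul_dom c d k"
    by (auto simp: mul_dom_def)
  finally show ?thesis .
qed

text \<open>Left translation is multiplication with its left argument frozen at the coordinates of
  \<open>h\<close>.\<close>

lemma smooth_left_mul: "smooth_map (mul h)"
  unfolding smooth_map_def
proof (intro conjI ballI)
  show "continuous_on UNIV (mul h)"
    using continuous_on_compose2[OF continuous_mul, of UNIV "\<lambda>q. (h, q)"]
    by (simp add: continuous_on_Pair)
  fix c d assume c: "c \<in> A" and d: "d \<in> A"
  let ?e = "chart_at A h"
  have "smooth_on {y. (snd ?e h, y) \<in> mul_dom ?e c d} (\<lambda>y. mul_chart ?e c d (snd ?e h, y))"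
    by (intro smooth_on_slices open_mul_dom smooth_mul_chart chart_at c d)
  moreover have "{y. (snd ?e h, y) \<in> mul_dom ?e c d} = chart_preimage c (mul h -` fst d)"
    by (auto simp: mul_dom_def chart_preimage_def chart_at chart_in_image chart_inv_chart)
  moreover have "(\<lambda>y. mul_chart ?e c d (snd ?e h, y)) = snd d \<circ> mul h \<circ> chart_inv c"
    by (simp add: mul_chart_def fun_eq_iff chart_at chart_inv_chart)
  ultimately show "smooth_on (chart_preimage c (mul h -` fst d)) (snd d \<circ> mul h \<circ> chart_inv c)"
    by simp
qed

definition left_field :: "real^'n \<Rightarrow> ('a, 'n) vfield" where
  "left_field v p = differential A (mul p) u v"

lemma left_field_chart_deriv: "left_field v p = chart_deriv (mul p) (chart_at A u) (chart_at A p) u v"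
  by (simp add: left_field_def differential_chart_deriv)

lemma linear_left_field: "linear (\<lambda>v. left_field v p)"
  unfolding left_field_chart_deriv[abs_def]
  using linear_chart_deriv[OF smooth_left_mul chart_at(1) chart_at(1) chart_at(2), of p u p]
  by (simp add: chart_at)

lemma left_field_unit [simp]: "left_field v u = v"
proof -
  have "mul u = (\<lambda>p. p)" by (simp add: fun_eq_iff)
  then show ?thesis by (simp add: left_field_chart_deriv chart_at chart_deriv_id)
qed

lemma left_field_invariant: "left_field v (mul h p) = differential A (mul h) p (left_field v p)"
proof -
  have "mul (mul h p) = (\<lambda>q. mul h (mul p q))" by (simp add: fun_eq_iff G.assoc)
  then show ?thesis
    unfolding left_field_chart_deriv differential_chart_deriv
    using chart_deriv_comp[of "mul h" "mul p" "chart_at A u" "chart_at A p" "chart_at A (mul h p)" u v]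
    by (simp add: smooth_left_mul chart_at)
qed

lemma left_field_eqI:
  assumes "\<And>h p. X (mul h p) = differential A (mul h) p (X p)"
  shows "X = left_field (X u)"
proof
  fix p show "X p = left_field (X u) p"
    using assms[of p u] by (simp add: left_field_def)
qed

text \<open>In a chart the field is the derivative of multiplication in the direction
  \<open>(0, v)\<close>, taken at \<open>(x, y0)\<close> with \<open>y0\<close> the coordinates of
  the unit. Smoothness in \<open>x\<close> rests on joint smoothness of multiplication; smoothness
  of each translation alone would not give it.\<close>

lemma smooth_left_field: "smooth_field A (left_field v)"
  unfolding smooth_field_def
proof
  fix c assume c: "c \<in> A"
  define d where "d = chart_at A u"
  define y0 where "y0 = snd d u"
  have d: "d \<in> A" "u \<in> fst d" by (simp_all add: d_def chart_at)
  have y0: "y0 \<in> chart_image d" "chart_inv d y0 = u"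
    using d by (simp_all add: y0_def chart_in_image chart_inv_chart)
  \<comment> \<open>Since \<open>mul p u = p\<close>, the chart \<open>c\<close> serves for the
    product as well, and the slice at \<open>y0\<close> is its whole image.\<close>
  have dom: "(x, y0) \<in> mul_dom c d c \<longleftrightarrow> x \<in> chart_image c" for x
    by (auto simp: mul_dom_def y0 chart_inv_in c)
  have sm: "smooth_on (mul_dom c d c) (mul_chart c d c)" by (intro smooth_mul_chart c d)
  have eq: "field_in_chart A c (left_field v) x = frechet_derivative (mul_chart c d c) (at (x, y0)) (0, v)"
    if x: "x \<in> chart_image c" for x
  proof -
    define p where "p = chart_inv c x"
    have p: "p \<in> fst c" "x = snd c p" using x c by (simp_all add: p_def chart_inv_in chart_chart_inv)
    have "field_in_chart A c (left_field v) x = chart_deriv (\<lambda>p. p) (chart_at A p) c p (left_field v p)"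
      unfolding p(2) by (rule field_in_chart_chart_deriv[OF c p(1)])
    also have "\<dots> = chart_deriv (\<lambda>p. p) (chart_at A p) c (mul p u) (chart_deriv (mul p) d (chart_at A p) u v)"
      by (simp add: left_field_chart_deriv d_def)
    also have "\<dots> = chart_deriv (mul p) d c u v"
      using chart_deriv_comp[OF smooth_map_id smooth_left_mul d(1) chart_at(1) c d(2), of p p v] p(1) by (simp add: chart_at)
    also have "\<dots> = frechet_derivative (mul_chart c d c \<circ> (\<lambda>y. (x, y))) (at y0) v"
      by (simp add: chart_deriv_def mul_chart_def p_def o_def y0_def)
    also have "\<dots> = frechet_derivative (mul_chart c d c) (at (x, y0)) (0, v)"
    proof -
      have "((\<lambda>y. (x, y)) has_derivative (\<lambda>v. (0, v))) (at y0)"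
        by (auto intro!: derivative_eq_intros)
      moreover have "(mul_chart c d c has_derivative frechet_derivative (mul_chart c d c) (at (x, y0))) (at (x, y0))"
        using smooth_on_differentiable[OF sm] dom x by (simp add: frechet_derivative_works)
      ultimately show ?thesis
        by (subst frechet_derivativeI[OF diff_chain_at]) (auto simp: o_def)
    qed
    finally show ?thesis .
  qed
  have "smooth_on {x. (x, y0) \<in> mul_dom c d c} (\<lambda>x. frechet_derivative (mul_chart c d c) (at (x, y0)) (0, v))"
    using smooth_on_slices(1)[OF open_mul_dom[OF c d(1) c] smooth_on_derivative[OF sm, of "(0, v)"], of y0] .
  then show "smooth_on (chart_image c) (field_in_chart A c (left_field v))"
    using smooth_on_cong[OF open_chart_image[OF c] eq] by (simp add: dom)
qed

lemma lie_algebra_eq: "lie_algebra A mul = range left_field"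
proof
  show "lie_algebra A mul \<subseteq> range left_field"
    using left_field_eqI unfolding lie_algebra_def by blast
  show "range left_field \<subseteq> lie_algebra A mul"
    using smooth_left_field left_field_invariant by (auto simp: lie_algebra_def)
qed

definition bracket :: "real^'n \<Rightarrow> real^'n \<Rightarrow> real^'n" where
  "bracket v w = lie_bracket A (left_field v) (left_field w) u"

lemma lie_bracket_left_field: "lie_bracket A (left_field v) (left_field w) = left_field (bracket v w)"
  unfolding bracket_def
  by (intro left_field_eqI lie_bracket_natural smooth_left_mul smooth_left_field left_field_invariant)

lemma bracket_skew: "bracket v w = - bracket w v"
  by (simp add: bracket_def lie_bracket_def)

lemma bracket_bracket_zero:
  assumes "two_step_nilpotent A mul"
  shows "bracket v (bracket w z) = 0"
proof -
  have bs: "(\<lambda>p. lie_bracket A X Y p) \<in> bracket_span A V U" if "X \<in> V" "Y \<in> U" for X Y V U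
    unfolding bracket_span_def mem_Collect_eq
    by (rule exI[of _ "1::nat"], rule exI[of _ "\<lambda>_. X"], rule exI[of _ "\<lambda>_. Y"]) (simp add: that)
  have "(\<lambda>p. lie_bracket A (left_field w) (left_field z) p) \<in> bracket_span A (lie_algebra A mul) (lie_algebra A mul)"
    by (rule bs) (auto simp: lie_algebra_eq)
  then have "(\<lambda>p. lie_bracket A (left_field v) (left_field (bracket w z)) p)
      \<in> bracket_span A (lie_algebra A mul) (bracket_span A (lie_algebra A mul) (lie_algebra A mul))"
    by (intro bs) (auto simp: lie_algebra_eq lie_bracket_left_field)
  then have "(\<lambda>p. lie_bracket A (left_field v) (left_field (bracket w z)) p) = (\<lambda>p. 0)"
    using assms unfolding two_step_nilpotent_def by simp
  then show ?thesis by (metis bracket_def)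
qed

lemma nonabelian_bracket:
  assumes "nonabelian A mul"
  shows "\<exists>v w. bracket v w \<noteq> 0"
proof (rule ccontr)
  assume "\<not> ?thesis"
  then have "lie_bracket A X Y p = 0" if "X \<in> lie_algebra A mul" "Y \<in> lie_algebra A mul" for X Y p
    using that linear_0[OF linear_left_field] by (auto simp: lie_algebra_eq lie_bracket_left_field)
  then have "bracket_span A (lie_algebra A mul) (lie_algebra A mul) \<subseteq> {\<lambda>p. 0}"
    by (auto simp: bracket_span_def)
  \<comment> \<open>The empty sum: the zero field always lies in the span, so
    \<open>nonabelian\<close> excludes exactly the case of vanishing brackets.\<close>
  moreover have "(\<lambda>p. 0) \<in> bracket_span A (lie_algebra A mul) (lie_algebra A mul)"
    unfolding bracket_span_def by (auto intro!: exI[of _ "0::nat"])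
  ultimately show False using assms unfolding nonabelian_def by blast
qed

end

section \<open>Left-invariant metrics\<close>

locale metric_lie_group = lie_group_manifold A mul u iv
  for A :: "('a::{t2_space,second_countable_topology}, 'n::finite) chart set"
    and mul :: "'a \<Rightarrow> 'a \<Rightarrow> 'a" and u :: 'a and iv :: "'a \<Rightarrow> 'a" +
  fixes g :: "('a, 'n) metric" and D :: "('a, 'n) vfield \<Rightarrow> ('a, 'n) vfield \<Rightarrow> ('a, 'n) vfield"
  assumes left_invariant_g: "left_invariant_metric A mul g"
    and levi_civita_D: "levi_civita A g D"
begin

lemma inner_product_form_g: "inner_product_form (g p)"
  using left_invariant_g by unfold_locales (auto simp: left_invariant_metric_def riemannian_metric_def)

lemma g_left_field: "g p (left_field v p) (left_field w p) = g u v w"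
proof -
  have "g (mul p u) (differential A (mul p) u v) (differential A (mul p) u w) = g u v w"
    using left_invariant_g unfolding left_invariant_metric_def by blast
  then show ?thesis by (simp add: left_field_def)
qed

lemma affine_D: "affine_connection A D"
  using levi_civita_D by (simp add: levi_civita_def)

lemma left_field_add: "left_field (v + w) = (\<lambda>p. left_field v p + left_field w p)"
  by (simp add: fun_eq_iff linear_add[OF linear_left_field])

lemma left_field_scale: "left_field (r *\<^sub>R v) = (\<lambda>p. r *\<^sub>R left_field v p)"
  by (simp add: fun_eq_iff linear_scale[OF linear_left_field])

lemma smooth_fun_const: "smooth_fun A (\<lambda>p. r)"
  by (simp add: smooth_fun_def o_def smooth_on_const)

lemma field_deriv_const: "field_deriv A X (\<lambda>p. r) p = 0"
  by (simp add: field_deriv_def o_def)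

section \<open>The connection on left-invariant fields\<close>

lemma linear_D_left:
  assumes Y: "smooth_field A Y"
  shows "linear (\<lambda>v. D (left_field v) Y p)"
proof (rule linearI)
  fix v w
  show "D (left_field (v + w)) Y p = D (left_field v) Y p + D (left_field w) Y p"
    unfolding left_field_add
    using affine_D[unfolded affine_connection_def, THEN conjunct2, THEN conjunct1, rule_format,
        OF smooth_left_field[of v] smooth_left_field[of w] Y]
    by (rule fun_cong)
next
  fix r v
  show "D (left_field (r *\<^sub>R v)) Y p = r *\<^sub>R D (left_field v) Y p"
    unfolding left_field_scale
    using affine_D[unfolded affine_connection_def, THEN conjunct2, THEN conjunct2, THEN conjunct1, rule_format,
        OF smooth_fun_const[of r] smooth_left_field[of v] Y]
    by (rule fun_cong)
qed

lemma linear_D_right: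
  assumes X: "smooth_field A X"
  shows "linear (\<lambda>v. D X (left_field v) p)"
proof (rule linearI)
  fix v w
  show "D X (left_field (v + w)) p = D X (left_field v) p + D X (left_field w) p"
    unfolding left_field_add
    using affine_D[unfolded affine_connection_def, THEN conjunct2, THEN conjunct2, THEN conjunct2, THEN conjunct1,
        rule_format, OF X smooth_left_field[of v] smooth_left_field[of w]]
    by (rule fun_cong)
next
  fix r v
  have "D X (\<lambda>p. r *\<^sub>R left_field v p) = (\<lambda>p. field_deriv A X (\<lambda>p. r) p *\<^sub>R left_field v p + r *\<^sub>R D X (left_field v) p)"
    by (rule affine_D[unfolded affine_connection_def, THEN conjunct2, THEN conjunct2, THEN conjunct2, THEN conjunct2,
        rule_format, OF smooth_fun_const[of r] X smooth_left_field[of v]])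
  then show "D X (left_field (r *\<^sub>R v)) p = r *\<^sub>R D X (left_field v) p"
    by (simp add: left_field_scale field_deriv_const)
qed

lemma torsion_free: "D (left_field v) (left_field w) p - D (left_field w) (left_field v) p = left_field (bracket v w) p"
  unfolding lie_bracket_left_field[symmetric]
  by (rule levi_civita_D[unfolded levi_civita_def, THEN conjunct2, THEN conjunct1, rule_format,
        OF smooth_left_field smooth_left_field])

lemma metric_compatible:
  "g p (D (left_field v) (left_field w) p) (left_field z p) + g p (left_field w p) (D (left_field v) (left_field z) p) = 0"
proof -
  have "field_deriv A (left_field v) (\<lambda>q. g q (left_field w q) (left_field z q)) p
      = g p (D (left_field v) (left_field w) p) (left_field z p) + g p (left_field w p) (D (left_field v) (left_field z) p)"
    by (rule levi_civita_D[unfolded levi_civita_def, THEN conjunct2, THEN conjunct2, rule_format,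
          OF smooth_left_field smooth_left_field smooth_left_field])
  then show ?thesis by (simp add: g_left_field field_deriv_const)
qed

text \<open>Freedom from torsion lets the bracket inherit its bilinearity from the connection, with
  no further calculation in charts.\<close>

lemma bracket_eq: "bracket v w = D (left_field v) (left_field w) u - D (left_field w) (left_field v) u"
  by (simp add: torsion_free)

lemma linear_bracket_right: "linear (bracket v)"
  unfolding bracket_eq[abs_def]
  by (intro linear_compose_sub linear_D_left linear_D_right smooth_left_field)

lemma linear_bracket_left: "linear (\<lambda>v. bracket v w)"
  unfolding bracket_eq[abs_def]
  by (intro linear_compose_sub linear_D_left linear_D_right smooth_left_field)

text \<open>The function \<open>K\<close> is skew in its last two arguments, by metric compatibility
  with constant inner products, and brackets are differences of \<open>K\<close> by freedom from
  torsion. In the alternating sum four of the six terms cancel.\<close>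

lemma koszul:
  "2 * g p (D (left_field v) (left_field w) p) (left_field z p)
   = g u (bracket v w) z - g u (bracket w z) v + g u (bracket z v) w"
proof -
  interpret G: inner_product_form "g p" by (rule inner_product_form_g)
  define K where "K v w z = g p (D (left_field v) (left_field w) p) (left_field z p)" for v w z
  have skew: "K v w z = - K v z w" for v w z
    using metric_compatible[of p v w z] G.sym_G[of "left_field w p"] by (simp add: K_def)
  have tor: "g u (bracket v w) z = K v w z - K w v z" for v w z
    unfolding K_def by (simp add: linear_diff[OF G.linear_G_left, symmetric] torsion_free g_left_field)
  show ?thesis
    unfolding tor using skew[of v w z] skew[of w v z] skew[of z w v] by (simp add: K_def)
qed

end

lemma matrix_inv_mat_1: "matrix_inv (mat 1 :: real^'n::finite^'n) = mat 1"
proof -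
  have "\<exists>B. (mat 1 :: real^'n^'n) ** B = mat 1 \<and> B ** mat 1 = mat 1"
    by (rule exI[of _ "mat 1"]) simp
  from someI_ex[OF this] show ?thesis by (simp add: matrix_inv_def)
qed

context metric_lie_group
begin

interpretation G: inner_product_form "g u"
  by (rule inner_product_form_g)

lemma weakly_einstein_imp_bracket_zero:
  assumes nilp: "two_step_nilpotent A mul"
    and we: "\<And>e i j. frame_at A e u \<Longrightarrow>
      R_check A g D e u i j = R_norm_sq A g D e u / real CARD('n) * g u (e i u) (e j u)"
  shows "bracket v w = 0"
proof -
  define Z where "Z = {z. \<forall>w. bracket z w = 0}"
  have sub: "subspace Z"
    by (auto simp: subspace_def Z_def linear_0[OF linear_bracket_left] linear_add[OF linear_bracket_left]
        linear_scale[OF linear_bracket_left])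
  obtain b :: "'n \<Rightarrow> real^'n" and S where
    "(\<forall>i j. g u (b i) (b j) = (if i = j then 1 else 0)) \<and>
    (\<forall>i\<in>S. b i \<in> Z) \<and> (\<forall>z\<in>Z. \<forall>k. k \<notin> S \<longrightarrow> g u z (b k) = 0)"
    using G.adapted_orthonormal_basis[OF sub] by blast
  then have b: "\<And>i j. g u (b i) (b j) = (if i = j then 1 else 0)"
    and bS: "\<And>i. i \<in> S \<Longrightarrow> b i \<in> Z" and bnS: "\<And>z k. z \<in> Z \<Longrightarrow> k \<notin> S \<Longrightarrow> g u z (b k) = 0"
    by blast+
  have expand: "x = (\<Sum>k\<in>UNIV. g u x (b k) *\<^sub>R b k)" for x
    by (rule G.orthonormal_family(3)[OF b])
  define c where "c i j k = g u (bracket (b i) (b j)) (b k)" for i j k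
  define e where "e i = left_field (b i)" for i
  have sm [simp]: "smooth_field A (e i)" for i by (simp add: e_def smooth_left_field)
  have eu [simp]: "e i u = b i" for i by (simp add: e_def)
  interpret C: two_step_constants c S
  proof
    show "c i j k = - c j i k" for i j k
      unfolding c_def bracket_skew[of "b i"] by (simp add: linear_neg[OF G.linear_G_left])
    show "i \<notin> S \<and> k \<in> S" if "c i j k \<noteq> 0" for i j k
    proof
      show "i \<notin> S"
        using that bS[of i] by (auto simp: c_def Z_def linear_0[OF G.linear_G_left])
      \<comment> \<open>Nilpotency makes every bracket central, so it has components only along the
        vectors indexed by \<open>S\<close>.\<close>
      have "bracket (bracket (b i) (b j)) w = 0" for w
        using bracket_skew[of "bracket (b i) (b j)" w] bracket_bracket_zero[OF nilp] by simp
      then have "bracket (b i) (b j) \<in> Z" by (simp add: Z_def)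
      then show "k \<in> S" using that bnS by (auto simp: c_def)
    qed
  qed
  have gam: "g p (D (e i) (e j) p) (e k p) = C.Christoffel i j k" for p i j k
    using koszul[of p "b i" "b j" "b k"] by (simp add: e_def C.Christoffel_def c_def)
  \<comment> \<open>An equality of fields, not only of values at \<open>u\<close>: the curvature
    applies \<open>D\<close> to this field once more.\<close>
  have De: "D (e i) (e j) = left_field (\<Sum>k\<in>UNIV. C.Christoffel i j k *\<^sub>R b k)" for i j
  proof
    fix p
    have "g p (e i p) (e j p) = (if i = j then 1 else 0)" for i j
      by (simp add: e_def g_left_field b)
    from inner_product_form.orthonormal_family(3)[OF inner_product_form_g this, of "D (e i) (e j) p"]
    show "D (e i) (e j) p = left_field (\<Sum>k\<in>UNIV. C.Christoffel i j k *\<^sub>R b k) p"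
      by (simp add: gam linear_sum[OF linear_left_field] linear_scale[OF linear_left_field] e_def[symmetric])
  qed
  have Br: "lie_bracket A (e i) (e j) = left_field (\<Sum>k\<in>UNIV. c i j k *\<^sub>R b k)" for i j
    using expand[of "bracket (b i) (b j)"] by (simp add: e_def lie_bracket_left_field c_def)
  have gam': "g u (D (e i) (left_field (\<Sum>m\<in>UNIV. f m *\<^sub>R b m)) u) (b l) = (\<Sum>m\<in>UNIV. f m * C.Christoffel i m l)"
    for f i l
    using gam[of u]
    by (simp add: linear_sum[OF linear_D_right[OF sm]] linear_scale[OF linear_D_right[OF sm]]
        linear_sum[OF G.linear_G_left] linear_scale[OF G.linear_G_left] e_def[symmetric])
  have gam'': "g u (D (left_field (\<Sum>m\<in>UNIV. f m *\<^sub>R b m)) (e k) u) (b l) = (\<Sum>m\<in>UNIV. f m * C.Christoffel m k l)"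
    for f k l
    using gam[of u]
    by (simp add: linear_sum[OF linear_D_left[OF sm]] linear_scale[OF linear_D_left[OF sm]]
        linear_sum[OF G.linear_G_left] linear_scale[OF G.linear_G_left] e_def[symmetric])
  have curv: "curv_low A g D e u i j k l = C.Riem i j k l" for i j k l
    unfolding curv_low_def curvature_def De Br eu linear_diff[OF G.linear_G_left] gam' gam''
    by (simp add: C.Riem_def sum_subtractf)
  \<comment> \<open>The frame is orthonormal at \<open>u\<close>, so raising indices changes no
    component.\<close>
  have gram: "gram g e u = mat 1"
    by (simp add: gram_def mat_def vec_eq_iff b)
  have mat1: "mat 1 $ i $ j * x = (if i = j then x else 0)" for i j :: 'n and x :: real
    by (simp add: mat_def)
  have up: "curv_up A g D e u j a b' c' = C.Riem j a b' c'" for j a b' c'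
    unfolding curv_up_def gram matrix_inv_mat_1 Let_def curv mult.assoc sum_distrib_left[symmetric] mat1
    by simp
  have frame: "frame_at A e u"
    using G.orthonormal_family(1,2)[OF b] by (simp add: frame_at_def)
  have "c i j k = 0" for i j k
  proof (rule C.weakly_einstein_imp_zero)
    show "(\<Sum>j\<in>UNIV. \<Sum>k\<in>UNIV. \<Sum>l\<in>UNIV. C.Riem i j k l * C.Riem i' j k l)
      = (if i = i' then R_norm_sq A g D e u / real CARD('n) else 0)" for i i'
      using we[OF frame, of i i'] by (simp add: R_check_def curv up b)
  qed
  then have "bracket (b i) (b j) = 0" for i j
    using expand[of "bracket (b i) (b j)"] by (simp add: c_def)
  moreover have "bracket v w = (\<Sum>j\<in>UNIV. g u w (b j) *\<^sub>R (\<Sum>i\<in>UNIV. g u v (b i) *\<^sub>R bracket (b i) (b j)))"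
  proof -
    have "bracket v w = bracket (\<Sum>i\<in>UNIV. g u v (b i) *\<^sub>R b i) (\<Sum>j\<in>UNIV. g u w (b j) *\<^sub>R b j)"
      using expand[of v] expand[of w] by simp
    then show ?thesis
      by (simp only: linear_sum[OF linear_bracket_left] linear_scale[OF linear_bracket_left]
          linear_sum[OF linear_bracket_right] linear_scale[OF linear_bracket_right])
  qed
  ultimately show ?thesis by simp
qed

end

theorem theorem1p2:
  fixes A :: "('a::{t2_space,second_countable_topology}, 'n::finite) chart set"
    and mul :: "'a \<Rightarrow> 'a \<Rightarrow> 'a" and u :: 'a and iv :: "'a \<Rightarrow> 'a"
  assumes "lie_group A mul u iv"
    and "nonabelian A mul"
    and "two_step_nilpotent A mul"
  shows "\<not> (\<exists>g. left_invariant_metric A mul g \<and> weakly_einstein A g)"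
proof
  assume "\<exists>g. left_invariant_metric A mul g \<and> weakly_einstein A g"
  then obtain g D where g: "left_invariant_metric A mul g" "levi_civita A g D"
    and we: "\<And>p e i j. frame_at A e p \<Longrightarrow>
      R_check A g D e p i j = R_norm_sq A g D e p / real CARD('n) * g p (e i p) (e j p)"
    unfolding weakly_einstein_def by blast
  interpret metric_lie_group A mul u iv g D
    using assms(1) g by unfold_locales
  show False
    using nonabelian_bracket[OF assms(2)] weakly_einstein_imp_bracket_zero[OF assms(3) we] by blast
qed

end
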